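(* Let $n\ge m\ge 1$ and let $(A_s,B_s)$, $A_s\in\mathbb{R}^{n\times n}$, $B_s\in\mathbb{R}^{n\times m}$, be in staircase form with block sizes $m=\omega_1\ge\omega_2\ge\dots\ge\omega_\mu\ge 1$, $\sum_{i=1}^{\mu}\omega_i=n$, and let $\mu_1\ge\dots\ge\mu_m\ge1$ be its controllability indices. Put $\omega_0=m$, $\omega_{\mu+1}=0$, $\epsilon_i=\omega_i-\omega_{i+1}$, and let $\mu=k_1>k_2>\dots>k_g$ be all the indices $i$ with $\epsilon_i>0$. Let $$C=\begin{bmatrix}C_1\\ \vdots\\ C_g\end{bmatrix}\in\mathbb{R}^{m\times n},\qquad C_j=\begin{bmatrix}0_{\epsilon_{k_j}\times(\omega_1+\dots+\omega_{k_j-1})} & S^r_{k_j} & S^f_{k_j}\end{bmatrix}\in\mathbb{R}^{\epsilon_{k_j}\times n},$$ where $S^f_{k_j}\in\mathbb{R}^{\epsilon_{k_j}\times\sum_{i=k_j+1}^{\mu}\omega_i}$ is arbitrary and $S^r_{k_j}\in\mathbb{R}^{\epsilon_{k_j}\times\omega_{k_j}}$ are such that the square matrices $S^r_{k_1}$ and $\begin{bmatrix}A^s_{k_j+1,k_j}\\ S^r_{k_j}\end{bmatrix}$, $j=2,\dots,g$, are all invertible. Let $C_{j_l}$ denote the $l$-th row of $C_j$ and define $$T=\operatorname{col}(T_j)_{j=1}^g,\quad T_j=\operatorname{col}(T_{j_l})_{l=1}^{\epsilon_{k_j}},\quad T_{j_l}=\operatorname{col}(C_{j_l}A_s^{i})_{i=0}^{k_j-1},$$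 $$D=\operatorname{col}(C_jA_s^{k_j-1}B_s)_{j=1}^g,\quad C^*=\operatorname{col}(C_jA_s^{k_j})_{j=1}^g,\quad G=D^{-1},\quad F=-D^{-1}C^*.$$ Then $(T,F,G)$ transforms $(A_s,B_s)$ to its Brunovsky form: $D$ and $T$ are invertible and $$T(A_s+B_sF)T^{-1}=A_b,\qquad TB_sG=B_b,$$ where $(A_b,B_b)$ is the Brunovsky form determined by $\mu_1\ge\dots\ge\mu_m$.
   Context: Notation: $\operatorname{col}(X_i)_{i=a}^{b}$ denotes the matrix obtained by stacking $X_a,X_{a+1},\dots,X_b$ vertically in this order; $\operatorname{blkdiag}(X_i)_{i=1}^m$ is the block diagonal matrix with diagonal blocks $X_1,\dots,X_m$. Staircase form: a pair $(A_s,B_s)$ is in staircase form with block sizes $m=\omega_1\ge\dots\ge\omega_\mu\ge1$, $\sum_{i=1}^\mu\omega_i=n$, $\omega_0:=m$, if $A_s=[A^s_{ij}]_{i,j=1}^{\mu}$ with blocks $A^s_{ij}\in\mathbb{R}^{\omega_i\times\omega_j}$ satisfying $A^s_{ij}=0$ for $i>j+1$; $B_s=\begin{bmatrix}A^s_{10}\\0\\ \vdots\\0\end{bmatrix}$ with $A^s_{10}\in\mathbb{R}^{\omega_1\times\omega_0}=\mathbb{R}^{m\times m}$; and $\operatorname{rank}A^s_{i,i-1}=\omega_i$ for $i=1,\dots,\mu$. (Such a pair is controllable.) Controllability indices: for a controllable pair $(A,B)$ with $B=[b_1\ \cdots\ b_m]$ of full column rank, select the first $n$ linearly independent columns of $[b_1\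 \cdots\ b_m\ Ab_1\ \cdots\ Ab_m\ \cdots\ A^{n-1}b_1\ \cdots\ A^{n-1}b_m]$ from left to right; the numbers of selected columns involving $b_1,\dots,b_m$, arranged in descending order, are the controllability indices $\mu_1\ge\dots\ge\mu_m\ge1$, and $\sum_i\mu_i=n$. For a staircase pair they form the partition of $n$ conjugate to $(\omega_1,\dots,\omega_\mu)$, i.e. $\mu_i=\#\{l:\omega_l\ge i\}$; in particular $\mu=\mu_1$, the distinct values of the $\mu_i$ are $k_1,\dots,k_g$, and the value $k_j$ occurs $\epsilon_{k_j}$ times. Brunovsky form determined by $\mu_1\ge\dots\ge\mu_m$: $A_b=\operatorname{blkdiag}(A^b_i)_{i=1}^m$ and $B_b=\operatorname{blkdiag}(B^b_i)_{i=1}^m$, where $A^b_i\in\mathbb{R}^{\mu_i\times\mu_i}$ has ones on the first superdiagonal and zeros elsewhere, and $B^b_i=[0\ \cdots\ 0\ 1]^{\top}\in\mathbb{R}^{\mu_i\times1}$. *)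

theory Defs
  imports
    "Jordan_Normal_Form.Jordan_Normal_Form"
    "Jordan_Normal_Form.Gauss_Jordan_Elimination"
    "Jordan_Normal_Form.DL_Rank"
begin

definition vstack :: "nat \<Rightarrow> 'a mat list \<Rightarrow> 'a mat" where
  "vstack nc Xs = mat_of_rows nc (concat (map rows Xs))"

definition hstack :: "nat \<Rightarrow> 'a mat list \<Rightarrow> 'a mat" where
  "hstack nr Xs = mat_of_cols nr (concat (map cols Xs))"

text \<open>Meaningful for invertible arguments only.\<close>

definition mat_inv :: "'a :: field mat \<Rightarrow> 'a mat" where
  "mat_inv A = the (mat_inverse A)"

text \<open>
  Block indices are 1-based, while matrix entries are 0-based. Block \<open>i \<ge> 1\<close> starts at index
  \<open>\<omega> 1 + \<dots> + \<omega> (i - 1)\<close>. Block index 0 also starts at 0, with width \<open>\<omega> 0\<close>; it is used for the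
  single block column of the input matrix.
\<close>

definition block :: "(nat \<Rightarrow> nat) \<Rightarrow> 'a mat \<Rightarrow> nat \<Rightarrow> nat \<Rightarrow> 'a mat" where
  "block \<omega> A i j =
     mat (\<omega> i) (\<omega> j) (\<lambda>(p, q). A $$ ((\<Sum>l = 1..<i. \<omega> l) + p, (\<Sum>l = 1..<j. \<omega> l) + q))"

text \<open>The block \<open>A\<^sub>1\<^sub>0\<close> of a staircase pair is the top block of the input matrix.\<close>

definition staircase_form ::
    "nat \<Rightarrow> nat \<Rightarrow> nat \<Rightarrow> (nat \<Rightarrow> nat) \<Rightarrow> 'a :: field mat \<Rightarrow> 'a mat \<Rightarrow> bool" where
  "staircase_form n m \<mu> \<omega> A B \<longleftrightarrow>
     A \<in> carrier_mat n n \<and> B \<in> carrier_mat n m \<and>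
     \<omega> 0 = m \<and> \<omega> 1 = m \<and>
     (\<forall>i\<in>{1..<\<mu>}. \<omega> (i + 1) \<le> \<omega> i) \<and> (\<forall>i\<in>{1..\<mu>}. 1 \<le> \<omega> i) \<and> (\<Sum>i = 1..\<mu>. \<omega> i) = n \<and>
     (\<forall>i\<in>{1..\<mu>}. \<forall>j\<in>{1..\<mu>}. i > j + 1 \<longrightarrow> block \<omega> A i j = 0\<^sub>m (\<omega> i) (\<omega> j)) \<and>
     (\<forall>i\<in>{2..\<mu>}. block \<omega> B i 0 = 0\<^sub>m (\<omega> i) m) \<and>
     vec_space.rank (\<omega> 1) (block \<omega> B 1 0) = \<omega> 1 \<and>
     (\<forall>i\<in>{2..\<mu>}. vec_space.rank (\<omega> i) (block \<omega> A i (i - 1)) = \<omega> i)"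

definition lin_indpt_vecs :: "nat \<Rightarrow> 'a :: field vec list \<Rightarrow> bool" where
  "lin_indpt_vecs n vs \<longleftrightarrow>
     distinct vs \<and> \<not> module.lin_dep class_ring (module_vec TYPE('a) n) (set vs)"

text \<open>The index pair \<open>(i, j)\<close> stands for the column \<open>A\<^sup>i b\<^sub>j\<close> of the controllability matrix.\<close>

definition ctrb_col :: "'a :: field mat \<Rightarrow> 'a mat \<Rightarrow> nat \<times> nat \<Rightarrow> 'a vec" where
  "ctrb_col A B = (\<lambda>(i, j). A ^\<^sub>m i *\<^sub>v col B j)"

text \<open>
  Scans the columns from left to right, keeping a column whenever it is linearly independent
  of those already kept (the accumulator).
\<close>

fun select_cols ::
    "'a :: field mat \<Rightarrow> 'a mat \<Rightarrow> (nat \<times> nat) list \<Rightarrow> (nat \<times> nat) list \<Rightarrow> (nat \<times> nat) list" where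
  "select_cols A B acc [] = acc"
| "select_cols A B acc (x # xs) =
     (if lin_indpt_vecs (dim_row A) (map (ctrb_col A B) (acc @ [x]))
      then select_cols A B (acc @ [x]) xs
      else select_cols A B acc xs)"

definition controllability_indices :: "'a :: field mat \<Rightarrow> 'a mat \<Rightarrow> nat list" where
  "controllability_indices A B =
     (let n = dim_row A; m = dim_col B;
          sel = select_cols A B [] (List.product [0..<n] [0..<m])
      in rev (sort (map (\<lambda>j. length (filter (\<lambda>x. snd x = j) sel)) [0..<m])))"

text \<open>A Jordan block for the eigenvalue 0 has ones on the first superdiagonal.\<close>

definition brunovsky_A :: "nat list \<Rightarrow> 'a :: field mat" where
  "brunovsky_A ks = diag_block_mat (map (\<lambda>k. jordan_block k 0) ks)"

definition brunovsky_B :: "nat list \<Rightarrow> 'a :: field mat" where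
  "brunovsky_B ks =
     diag_block_mat (map (\<lambda>k. mat k 1 (\<lambda>(i, _). if i = k - 1 then 1 else 0)) ks)"

end

theory Submission
  imports Defs
begin

text \<open>
Call a family of row vectors \<open>c\<^sub>a\<close> with lengths \<open>k\<^sub>a \<ge> 1\<close>, \<open>a < m\<close>, whose lengths add up to the state
dimension \<open>n\<close>, a family of flat outputs of the pair \<open>(A, B)\<close> if \<open>c\<^sub>a A\<^sup>i B = 0\<close> whenever
\<open>i + 1 < k\<^sub>a\<close> and the square matrix \<open>D\<close> with rows \<open>c\<^sub>a A\<^bsup>k\<^sub>a - 1\<^esup> B\<close> is invertible. The theorem
splits into two independent statements: the rows of the matrices \<open>C\<^sub>j\<close> are flat outputs of a staircase
pair, and flat outputs of any pair yield the Brunovsky form and the controllability indices.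

For the second statement, regard the functionals \<open>c\<^sub>a A\<^sup>s\<close>, \<open>s < k\<^sub>a\<close>, as coordinates; they are the rows of
\<open>T\<close>. An input \<open>u\<close> applied \<open>t\<close> steps ago contributes \<open>A\<^sup>t B u\<close> to the state. It changes no coordinate
\<open>(a, s)\<close> with \<open>s + t + 1 < k\<^sub>a\<close>, and it changes the coordinates with \<open>s + t + 1 = k\<^sub>a\<close> by the entries of
\<open>D u\<close>, which can be prescribed because \<open>D\<close> is invertible. So any coordinate values can be produced by
choosing the inputs one after the other, the earliest first (lemma \<open>reach_realises_coords\<close>). Hence
\<open>T\<close> is surjective and thus invertible, and the space \<open>reach t\<close> spanned by the columns \<open>A\<^sup>i b\<^sub>j\<close> with
\<open>i < t\<close> consists exactly of the vectors whose coordinates \<open>(a, s)\<close> with \<open>s + t < k\<^sub>a\<close> vanish. Its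
dimension is therefore the sum of the numbers \<open>min t k\<^sub>a\<close> (lemma \<open>card_basis_reach\<close>).

The columns selected from the first \<open>t\<close> blocks of the controllability matrix form a basis of
\<open>reach t\<close>. Moreover \<open>A\<^bsup>i + 1\<^esup> b\<^sub>j\<close> is selected only if \<open>A\<^sup>i b\<^sub>j\<close> is, so the number of columns selected
from the first \<open>t\<close> blocks is also the sum of the numbers \<open>min t \<mu>\<^sub>j\<close>, where the \<open>\<mu>\<^sub>j\<close> are the
controllability indices. Equality of these sums for all \<open>t\<close> makes the indices a rearrangement of the \<open>k\<^sub>a\<close>
(theorem \<open>controllability_indices_eq_lengths\<close>). The Brunovsky equations then are a comparison of
rows: \<open>A\<close> takes the coordinate \<open>(a, s)\<close> to \<open>(a, s + 1)\<close>, and the feedback cancels \<open>c\<^sub>a A\<^bsup>k\<^sub>a\<^esup>\<close>.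

For the first statement, let \<open>lead i\<close> be the space of vectors that vanish outside the first \<open>i\<close> blocks.
By the staircase shape \<open>A\<^sup>i B u\<close> lies in \<open>lead (i + 1)\<close>, whereas a row of \<open>C\<^sub>j\<close> annihilates
\<open>lead (k\<^sub>j - 1)\<close>; so the products \<open>C\<^sub>j A\<^sup>i B\<close> with \<open>i + 1 < k\<^sub>j\<close> vanish. Suppose \<open>D u = 0\<close>, and let \<open>x\<^sub>i\<close> be the
\<open>i\<close>-th block of \<open>A\<^bsup>i - 1\<^esup> B u\<close>. Then \<open>x\<^sub>i\<^sub>+\<^sub>1\<close> is the product of the subdiagonal block
\<open>A\<^sub>i\<^sub>+\<^sub>1\<^sub>,\<^sub>i\<close> with \<open>x\<^sub>i\<close>, and \<open>D u = 0\<close> says that \<open>S\<^sup>r\<^sub>i x\<^sub>i = 0\<close> for every \<open>i\<close> among the \<open>k\<^sub>j\<close>.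
Descending in \<open>i\<close>, the invertibility hypotheses give \<open>x\<^sub>i = 0\<close>; where \<open>\<epsilon>\<^sub>i = 0\<close> the subdiagonal block is square of full
rank and does the same. At the bottom \<open>B u = 0\<close>, so \<open>u = 0\<close> (lemma \<open>det_decoupling\<close>).
\<close>

section \<open>Matrices and their rows\<close>

lemma pow_mat_add:
  fixes A :: "'a :: semiring_1 mat"
  assumes "A \<in> carrier_mat n n"
  shows "A ^\<^sub>m (s + t) = A ^\<^sub>m s * A ^\<^sub>m t"
proof (induction t)
  case (Suc t)
  then show ?case
    using assms by (simp add: assoc_mult_mat[of _ n n _ n _ n])
qed (use assms in simp)

lemma mult_mat_unit_vec:
  fixes B :: "'a :: semiring_1 mat"
  assumes "B \<in> carrier_mat n m" and "j < m"
  shows "B *\<^sub>v unit_vec m j = col B j"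
  using assms by (intro eq_vecI) auto

lemma mat_inv_invertible:
  assumes "A \<in> carrier_mat n n" and "det A \<noteq> 0"
  shows "invertible_mat A" and "mat_inv A \<in> carrier_mat n n"
    and "A * mat_inv A = 1\<^sub>m n" and "mat_inv A * A = 1\<^sub>m n"
proof -
  have "A \<in> Units (ring_mat TYPE('a) n ())"
    using det_non_zero_imp_unit[OF assms] .
  then obtain B where "mat_inverse A = Some B"
    using mat_inverse(1)[OF assms(1), of "()"] by (cases "mat_inverse A") auto
  then have B: "A * B = 1\<^sub>m n" "B * A = 1\<^sub>m n" "B \<in> carrier_mat n n" and eq: "mat_inv A = B"
    using mat_inverse(2)[OF assms(1)] by (auto simp: mat_inv_def)
  show "mat_inv A \<in> carrier_mat n n" "A * mat_inv A = 1\<^sub>m n" "mat_inv A * A = 1\<^sub>m n"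
    using B eq by auto
  show "invertible_mat A"
    unfolding invertible_mat_def inverts_mat_def square_mat.simps
    using B assms(1) by (intro conjI exI[of _ B]) auto
qed

lemma mult_mat_vec_eq_0_imp_det_nonzero:
  fixes A :: "'a :: field mat"
  assumes "A \<in> carrier_mat n n"
    and "\<And>v. v \<in> carrier_vec n \<Longrightarrow> A *\<^sub>v v = 0\<^sub>v n \<Longrightarrow> v = 0\<^sub>v n"
  shows "det A \<noteq> 0"
  using assms det_0_iff_vec_prod_zero_field[OF assms(1)] by auto

lemma surj_imp_det_nonzero:
  fixes A :: "'a :: field mat"
  assumes A: "A \<in> carrier_mat n n"
    and surj: "\<And>w. w \<in> carrier_vec n \<Longrightarrow> \<exists>v \<in> carrier_vec n. A *\<^sub>v v = w"
  shows "det A \<noteq> 0"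
proof -
  obtain v where v: "\<And>i. i < n \<Longrightarrow> v i \<in> carrier_vec n \<and> A *\<^sub>v v i = unit_vec n i"
    using bchoice[of "{..<n}" "\<lambda>i v. v \<in> carrier_vec n \<and> A *\<^sub>v v = unit_vec n i"]
      surj[OF unit_vec_carrier] by auto
  define V where "V = mat_of_cols n (map v [0..<n])"
  have V: "V \<in> carrier_mat n n"
    unfolding V_def by (rule carrier_matI) auto
  have "A * V = 1\<^sub>m n"
  proof (rule mat_col_eqI)
    fix j assume "j < dim_col (1\<^sub>m n :: 'a mat)"
    then have j: "j < n" by simp
    have "col V j = v j"
      unfolding V_def using v j by (subst col_mat_of_cols) auto
    then show "col (A * V) j = col (1\<^sub>m n) j"
      using v[OF j] col_mult2[OF A V j] j by simp
  qed (use A V in auto)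
  then have "det A * det V = 1"
    using det_mult[OF A V] by simp
  then show ?thesis by auto
qed

lemma invertible_mat_imp_kernel_trivial:
  fixes A :: "'a :: comm_ring_1 mat"
  assumes "invertible_mat A" and A: "A \<in> carrier_mat n n" and v: "v \<in> carrier_vec n"
    and "A *\<^sub>v v = 0\<^sub>v n"
  shows "v = 0\<^sub>v n"
proof -
  obtain B where AB: "A * B = 1\<^sub>m n" and BA: "B * A = 1\<^sub>m (dim_row B)"
    using assms(1) A unfolding invertible_mat_def inverts_mat_def by auto
  have B: "B \<in> carrier_mat n n"
    using A arg_cong[OF AB, of dim_col] arg_cong[OF BA, of dim_col] by auto
  have "v = (B * A) *\<^sub>v v"
    using B v BA by simp
  also have "\<dots> = B *\<^sub>v (A *\<^sub>v v)"
    using A B v by (intro assoc_mult_mat_vec) auto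
  also have "\<dots> = 0\<^sub>v n"
    using B assms(4) by auto
  finally show ?thesis .
qed

text \<open>Row vectors are kept as vectors, so the row vector \<open>u M\<close> appears as \<open>M\<^sup>T *\<^sub>v u\<close> throughout.\<close>

lemma mat_of_rows_mult:
  fixes M :: "'a :: comm_semiring_0 mat"
  assumes "set us \<subseteq> carrier_vec n" and "M \<in> carrier_mat n nc"
  shows "mat_of_rows n us * M = mat_of_rows nc (map (\<lambda>u. M\<^sup>T *\<^sub>v u) us)"
proof (rule eq_matI)
  fix i j assume "i < dim_row (mat_of_rows nc (map (\<lambda>u. M\<^sup>T *\<^sub>v u) us))"
    and "j < dim_col (mat_of_rows nc (map (\<lambda>u. M\<^sup>T *\<^sub>v u) us))"
  then have ij: "i < length us" "j < nc" by auto
  then have u: "us ! i \<in> carrier_vec n"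
    using assms(1) nth_mem by blast
  have "(mat_of_rows n us * M) $$ (i, j) = us ! i \<bullet> col M j"
    using ij assms u by simp
  also have "\<dots> = col M j \<bullet> us ! i"
    using assms(2) u ij by (intro comm_scalar_prod[of _ n]) auto
  finally show "(mat_of_rows n us * M) $$ (i, j) = mat_of_rows nc (map (\<lambda>u. M\<^sup>T *\<^sub>v u) us) $$ (i, j)"
    using ij assms(2) by (simp add: mat_of_rows_index)
qed (use assms in auto)

lemma rows_mult:
  fixes M :: "'a :: comm_semiring_0 mat"
  assumes "X \<in> carrier_mat nr n" and "M \<in> carrier_mat n nc"
  shows "rows (X * M) = map (\<lambda>u. M\<^sup>T *\<^sub>v u) (rows X)"
proof -
  have X: "mat_of_rows n (rows X) = X"
    using mat_of_rows_rows[of X] assms(1) by (simp only: carrier_matD(2))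
  have rows: "set (rows X) \<subseteq> carrier_vec n"
    using rows_carrier[of X] assms(1) by (simp only: carrier_matD(2))
  have "X * M = mat_of_rows nc (map (\<lambda>u. M\<^sup>T *\<^sub>v u) (rows X))"
    using mat_of_rows_mult[OF rows assms(2)] unfolding X .
  moreover have "set (map (\<lambda>u. M\<^sup>T *\<^sub>v u) (rows X)) \<subseteq> carrier_vec nc"
  proof
    fix v assume "v \<in> set (map (\<lambda>u. M\<^sup>T *\<^sub>v u) (rows X))"
    then obtain u where "v = M\<^sup>T *\<^sub>v u" unfolding set_map by blast
    then show "v \<in> carrier_vec nc"
      using assms(2) by (intro carrier_vecI) simp
  qed
  ultimately show ?thesis
    by (simp only: rows_mat_of_rows)
qed

lemma mat_of_rows_append:
  "mat_of_rows n (us @ vs) = mat_of_rows n us @\<^sub>r mat_of_rows n vs"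
proof (rule eq_matI)
  fix i j assume "i < dim_row (mat_of_rows n us @\<^sub>r mat_of_rows n vs)"
    "j < dim_col (mat_of_rows n us @\<^sub>r mat_of_rows n vs)"
  then have "i < length us + length vs" "j < n"
    by (simp_all add: append_rows_def)
  then show "mat_of_rows n (us @ vs) $$ (i, j) = (mat_of_rows n us @\<^sub>r mat_of_rows n vs) $$ (i, j)"
    by (cases "i < length us") (simp_all add: append_rows_def mat_of_rows_index nth_append)
qed (simp_all add: append_rows_def)

lemma block_diag_mult_append_rows:
  fixes M N :: "'a :: comm_semiring_1 mat"
  assumes "M \<in> carrier_mat r1 c1" "N \<in> carrier_mat r2 c2"
    and "X \<in> carrier_mat c1 n" "Y \<in> carrier_mat c2 n"
  shows "four_block_mat M (0\<^sub>m r1 c2) (0\<^sub>m r2 c1) N * (X @\<^sub>r Y) = (M * X) @\<^sub>r (N * Y)"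
proof -
  have "four_block_mat M (0\<^sub>m r1 c2) (0\<^sub>m r2 c1) N
      * four_block_mat X (0\<^sub>m c1 0) Y (0\<^sub>m c2 0)
    = four_block_mat (M * X + 0\<^sub>m r1 c2 * Y) (M * 0\<^sub>m c1 0 + 0\<^sub>m r1 c2 * 0\<^sub>m c2 0)
        (0\<^sub>m r2 c1 * X + N * Y) (0\<^sub>m r2 c1 * 0\<^sub>m c1 0 + N * 0\<^sub>m c2 0)"
    using assms by (intro mult_four_block_mat) auto
  also have "\<dots> = four_block_mat (M * X) (0\<^sub>m r1 0) (N * Y) (0\<^sub>m r2 0)"
    using assms by (intro cong_four_block_mat) auto
  finally show ?thesis
    using assms unfolding append_rows_def by simp
qed

section \<open>Products with a Brunovsky pair\<close>

lemma brunovsky_A_carrier [simp]: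
  "brunovsky_A ks \<in> carrier_mat (sum_list ks) (sum_list ks)"
  unfolding brunovsky_A_def by (rule carrier_matI) (simp_all add: dim_diag_block_mat comp_def)

lemma brunovsky_B_carrier [simp]:
  "brunovsky_B ks \<in> carrier_mat (sum_list ks) (length ks)"
  unfolding brunovsky_B_def
  by (rule carrier_matI) (simp_all add: dim_diag_block_mat comp_def sum_list_triv)

lemma brunovsky_A_Cons:
  "brunovsky_A (k # ks) = four_block_mat (jordan_block k 0) (0\<^sub>m k (sum_list ks))
     (0\<^sub>m (sum_list ks) k) (brunovsky_A ks)"
  unfolding brunovsky_A_def by (simp add: dim_diag_block_mat comp_def Let_def)

lemma brunovsky_B_Cons:
  "brunovsky_B (k # ks) = four_block_mat (mat k 1 (\<lambda>(i, _). if i = k - 1 then 1 else 0))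
     (0\<^sub>m k (length ks)) (0\<^sub>m (sum_list ks) 1) (brunovsky_B ks)"
  unfolding brunovsky_B_def by (simp add: dim_diag_block_mat comp_def Let_def sum_list_triv)

text \<open>Multiplication by the state matrix of a Brunovsky pair shifts each block of rows up by one and fills the
gap with zero. The blocks are given as lists of rows, so that their sizes need no separate bookkeeping.\<close>

lemma brunovsky_A_mult:
  fixes rss :: "'a :: field vec list list"
  assumes "\<And>rs. rs \<in> set rss \<Longrightarrow> rs \<noteq> []"
  shows "brunovsky_A (map length rss) * mat_of_rows n (concat rss)
    = mat_of_rows n (concat (map (\<lambda>rs. tl rs @ [0\<^sub>v n]) rss))"
  using assms
proof (induction rss)
  case Nil
  then show ?case by (intro eq_matI) (auto simp: brunovsky_A_def)
next
  case (Cons rs rss)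
  then have ne: "rs \<noteq> []" by simp
  let ?k = "length rs" and ?J = "jordan_block (length rs) (0 :: 'a)"
  have J: "?J * mat_of_rows n rs = mat_of_rows n (tl rs @ [0\<^sub>v n])"
  proof (rule eq_matI)
    fix i j assume "i < dim_row (mat_of_rows n (tl rs @ [0\<^sub>v n]))"
      and "j < dim_col (mat_of_rows n (tl rs @ [0\<^sub>v n]))"
    with ne have ij: "i < ?k" "j < n" by auto
    have "(?J * mat_of_rows n rs) $$ (i, j)
        = (\<Sum>l\<in>{0..<?k}. ?J $$ (i, l) * mat_of_rows n rs $$ (l, j))"
      using ij by (simp add: scalar_prod_def)
    also have "\<dots> = (\<Sum>l\<in>{0..<?k}. if l = Suc i then mat_of_rows n rs $$ (l, j) else 0)"
      using ij by (intro sum.cong) (auto simp: jordan_block_def)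
    also have "\<dots> = (if Suc i < ?k then rs ! Suc i $ j else 0)"
      using ij by (simp add: mat_of_rows_index)
    also have "\<dots> = mat_of_rows n (tl rs @ [0\<^sub>v n]) $$ (i, j)"
      using ij ne by (auto simp: mat_of_rows_index nth_append nth_tl)
    finally show "(?J * mat_of_rows n rs) $$ (i, j) = mat_of_rows n (tl rs @ [0\<^sub>v n]) $$ (i, j)" .
  qed (use ne in auto)
  have len: "length (concat rss) = sum_list (map length rss)"
    by (simp add: length_concat)
  have "brunovsky_A (map length (rs # rss)) * mat_of_rows n (concat (rs # rss))
      = (?J * mat_of_rows n rs) @\<^sub>r (brunovsky_A (map length rss) * mat_of_rows n (concat rss))"
    unfolding list.map brunovsky_A_Cons concat.simps mat_of_rows_append
    using len mat_of_rows_carrier(1)[of n "concat rss"]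
    by (intro block_diag_mult_append_rows[of _ _ _ _ _ _ _ n]) simp_all
  also have "\<dots> = mat_of_rows n (concat (map (\<lambda>rs. tl rs @ [0\<^sub>v n]) (rs # rss)))"
    using Cons J by (simp add: mat_of_rows_append[symmetric])
  finally show ?case .
qed

text \<open>Multiplication by the input matrix of a Brunovsky pair places the \<open>a\<close>-th row at the end of the
\<open>a\<close>-th block.\<close>

lemma brunovsky_B_mult:
  fixes ys :: "(nat \<times> 'a :: field vec) list"
  assumes "\<And>k u. (k, u) \<in> set ys \<Longrightarrow> 1 \<le> k"
  shows "brunovsky_B (map fst ys) * mat_of_rows n (map snd ys)
    = mat_of_rows n (concat (map (\<lambda>(k, u). replicate (k - 1) (0\<^sub>v n) @ [u]) ys))"
  using assms
proof (induction ys)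
  case Nil
  then show ?case by (intro eq_matI) (auto simp: brunovsky_B_def)
next
  case (Cons y ys)
  obtain k u where y: "y = (k, u)" by force
  with Cons have k: "1 \<le> k" by auto
  let ?E = "mat k 1 (\<lambda>(i, _). if i = k - 1 then 1 else 0) :: 'a mat"
  have E: "?E * mat_of_rows n [u] = mat_of_rows n (replicate (k - 1) (0\<^sub>v n) @ [u])"
    using k by (intro eq_matI) (auto simp: mat_of_rows_index nth_append scalar_prod_def)
  have "brunovsky_B (map fst (y # ys)) * mat_of_rows n (map snd (y # ys))
      = (brunovsky_B (k # map fst ys)) * mat_of_rows n ([u] @ map snd ys)"
    by (simp add: y)
  also have "\<dots> = (?E * mat_of_rows n [u]) @\<^sub>r (brunovsky_B (map fst ys) * mat_of_rows n (map snd ys))"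
    unfolding brunovsky_B_Cons mat_of_rows_append
    using brunovsky_B_carrier[of "map fst ys"] mat_of_rows_carrier(1)[of n "map snd ys"]
      mat_of_rows_carrier(1)[of n "[u]"]
    by (simp only: length_map, intro block_diag_mult_append_rows[of _ _ _ _ _ _ _ n]) simp_all
  also have "\<dots> = mat_of_rows n (replicate (k - 1) (0\<^sub>v n) @ [u])
      @\<^sub>r mat_of_rows n (concat (map (\<lambda>(k, u). replicate (k - 1) (0\<^sub>v n) @ [u]) ys))"
    unfolding E using Cons.prems by (subst Cons.IH) (auto intro: list.set_intros)
  also have "\<dots> = mat_of_rows n (concat (map (\<lambda>(k, u). replicate (k - 1) (0\<^sub>v n) @ [u]) (y # ys)))"
    unfolding mat_of_rows_append[symmetric] by (simp add: y)
  finally show ?case .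
qed

section \<open>Subspaces spanned by the columns of the controllability matrix\<close>

locale control_pair = vec_space "TYPE('a)" n
  for n m :: nat and A B :: "'a :: field mat" +
  assumes A: "A \<in> carrier_mat n n" and B: "B \<in> carrier_mat n m"
begin

lemma mult_mat_vec_in_span_cols:
  assumes "M \<in> carrier_mat n nc" and "u \<in> carrier_vec nc"
  shows "M *\<^sub>v u \<in> span (set (cols M))"
proof -
  have cols: "set (cols M) \<subseteq> carrier_vec n"
    using assms cols_dim by blast
  have "M *\<^sub>v u = mat_of_cols n (cols M) *\<^sub>v vec (length (cols M)) (\<lambda>i. u $ i)"
    using assms by (auto intro!: arg_cong2[of _ _ _ _ "(*\<^sub>v)"])
  also have "\<dots> = lincomb_list (\<lambda>i. u $ i) (cols M)"
    by (rule lincomb_list_as_mat_mult[symmetric]) (use cols in auto)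
  also have "\<dots> \<in> span_list (cols M)"
    by (rule in_span_listI[OF _ refl]) simp
  finally show ?thesis
    using span_list_as_span[OF cols] by simp
qed

text \<open>Columns outside \<open>Q\<close> meet zero entries of \<open>u\<close>, so they can be replaced by zero columns.\<close>

lemma mult_mat_vec_in_span_support:
  assumes M: "M \<in> carrier_mat n nc" and u: "u \<in> carrier_vec nc"
    and supp: "\<And>p. p < nc \<Longrightarrow> p \<notin> Q \<Longrightarrow> u $ p = 0" and Q: "Q \<subseteq> {..<nc}"
  shows "M *\<^sub>v u \<in> span (col M ` Q)"
proof -
  define M' where "M' = mat_of_cols n (map (\<lambda>p. if p \<in> Q then col M p else 0\<^sub>v n) [0..<nc])"
  have M': "M' \<in> carrier_mat n nc"
    unfolding M'_def by (rule carrier_matI) auto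
  have colQ: "col M ` Q \<subseteq> carrier_vec n"
    using M by auto
  have "M *\<^sub>v u = M' *\<^sub>v u"
  proof (rule eq_vecI)
    fix i assume "i < dim_vec (M' *\<^sub>v u)"
    then have i: "i < n" using M' by simp
    show "(M *\<^sub>v u) $ i = (M' *\<^sub>v u) $ i"
      using i M M' u supp by (auto simp: scalar_prod_def M'_def mat_of_cols_index intro!: sum.cong)
  qed (use M M' in auto)
  also have "\<dots> \<in> span (set (cols M'))"
    by (rule mult_mat_vec_in_span_cols[OF M' u])
  also have "span (set (cols M')) \<subseteq> span (col M ` Q)"
  proof (rule span_subsetI[OF colQ])
    have "set (cols M') \<subseteq> insert (0\<^sub>v n) (col M ` Q)"
      unfolding M'_def using M by (subst cols_mat_of_cols) auto
    moreover have "0\<^sub>v n \<in> span (col M ` Q)"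
      using in_spanI[of "0\<^sub>v n" "\<lambda>_. 0" "{}"] by simp
    ultimately show "set (cols M') \<subseteq> span (col M ` Q)"
      using in_own_span[OF colQ] by blast
  qed
  finally show ?thesis .
qed

lemma scalar_prod_span_eq_0:
  assumes "S \<subseteq> carrier_vec n" and x: "x \<in> carrier_vec n"
    and "\<And>y. y \<in> S \<Longrightarrow> x \<bullet> y = 0" and "v \<in> span S"
  shows "x \<bullet> v = 0"
proof -
  have "x \<in> orthogonal_complement S"
    using assms unfolding orthogonal_complement_def by auto
  then have "x \<in> orthogonal_complement (span S)"
    using in_orthogonal_complement_span[OF assms(1)] by simp
  then show ?thesis
    using assms(4) unfolding orthogonal_complement_def by auto
qed

lemma card_le_of_subset_span:
  assumes "finite S" "lin_indpt S" "finite S'" "S' \<subseteq> carrier_vec n" "S \<subseteq> span S'"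
  shows "card S \<le> card S'"
  using replacement[of S S'] assms by auto

lemma ctrb_col_carrier [simp]:
  "j < m \<Longrightarrow> ctrb_col A B (i, j) \<in> carrier_vec n"
  unfolding ctrb_col_def using A B by (auto intro!: mult_mat_vec_carrier[of _ n n])

lemma ctrb_col_carrier': "snd x < m \<Longrightarrow> ctrb_col A B x \<in> carrier_vec n"
  by (cases x) simp

text \<open>The states of \<open>x' = A x + B u\<close> that can be reached from the origin in at most \<open>t\<close> steps.\<close>

definition reach :: "nat \<Rightarrow> 'a vec set" where
  "reach t = span (ctrb_col A B ` ({..<t} \<times> {..<m}))"

lemma ctrb_cols_carrier: "ctrb_col A B ` ({..<t} \<times> {..<m}) \<subseteq> carrier_vec n"
  by auto

lemma reach_carrier: "v \<in> reach t \<Longrightarrow> v \<in> carrier_vec n"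
  unfolding reach_def using span_is_subset2[OF ctrb_cols_carrier] by auto

lemma reach_mono: "t \<le> t' \<Longrightarrow> reach t \<subseteq> reach t'"
  unfolding reach_def by (intro span_is_monotone) auto

lemma reach_add: "v \<in> reach t \<Longrightarrow> w \<in> reach t \<Longrightarrow> v + w \<in> reach t"
  unfolding reach_def by (rule span_add1[OF ctrb_cols_carrier])

lemma pow_mult_input_in_reach:
  assumes "u \<in> carrier_vec m"
  shows "A ^\<^sub>m t *\<^sub>v (B *\<^sub>v u) \<in> reach (Suc t)"
proof -
  have M: "A ^\<^sub>m t * B \<in> carrier_mat n m"
    using mult_carrier_mat[OF pow_carrier_mat[OF A] B] .
  have "A ^\<^sub>m t *\<^sub>v (B *\<^sub>v u) = (A ^\<^sub>m t * B) *\<^sub>v u"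
    using A B assms by (subst assoc_mult_mat_vec[of _ n n _ m]) auto
  also have "\<dots> \<in> span (set (cols (A ^\<^sub>m t * B)))"
    by (rule mult_mat_vec_in_span_cols[OF M assms])
  also have "\<dots> \<subseteq> reach (Suc t)"
    unfolding reach_def
  proof (rule span_is_monotone, rule subsetI)
    fix v assume "v \<in> set (cols (A ^\<^sub>m t * B))"
    then obtain j where j: "j < m" "v = col (A ^\<^sub>m t * B) j"
      using M by (auto simp: in_set_conv_nth)
    then have "v = ctrb_col A B (t, j)"
      unfolding ctrb_col_def using A B by (simp add: col_mult2[of _ n n])
    then show "v \<in> ctrb_col A B ` ({..<Suc t} \<times> {..<m})"
      using j by auto
  qed
  finally show ?thesis .
qed

end

section \<open>Coordinates from flat outputs\<close>

text \<open>The lengths \<open>k a\<close> are the relative degrees of the outputs \<open>c a\<close>, and the last assumption is the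
invertibility of the decoupling matrix. The condition that the relative degrees exhaust the state
dimension is what makes the outputs flat.\<close>

locale flat_outputs = control_pair n m A B
  for n m :: nat and A B :: "'a :: field mat" +
  fixes c :: "nat \<Rightarrow> 'a vec" and k :: "nat \<Rightarrow> nat"
  assumes c: "a < m \<Longrightarrow> c a \<in> carrier_vec n"
    and k_pos: "a < m \<Longrightarrow> 1 \<le> k a"
    and sum_k: "(\<Sum>a<m. k a) = n"
    and no_early_input: "a < m \<Longrightarrow> i + 1 < k a \<Longrightarrow> (A ^\<^sub>m i * B)\<^sup>T *\<^sub>v c a = 0\<^sub>v m"
    and det_input_rows:
      "det (mat_of_rows m (map (\<lambda>a. (A ^\<^sub>m (k a - 1) * B)\<^sup>T *\<^sub>v c a) [0..<m])) \<noteq> 0"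
begin

text \<open>The row vector \<open>c\<^sub>a A\<^sup>s\<close>.\<close>

definition coord :: "nat \<Rightarrow> nat \<Rightarrow> 'a vec" where
  "coord a s = (A ^\<^sub>m s)\<^sup>T *\<^sub>v c a"

definition T :: "'a mat" where
  "T = mat_of_rows n (concat (map (\<lambda>a. map (coord a) [0..<k a]) [0..<m]))"

definition D :: "'a mat" where
  "D = mat_of_rows m (map (\<lambda>a. (A ^\<^sub>m (k a - 1) * B)\<^sup>T *\<^sub>v c a) [0..<m])"

definition C' :: "'a mat" where
  "C' = mat_of_rows n (map (\<lambda>a. coord a (k a)) [0..<m])"

lemma coord_carrier [simp]: "a < m \<Longrightarrow> coord a s \<in> carrier_vec n"
  unfolding coord_def using A c by (auto intro!: mult_mat_vec_carrier[of _ n n])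

lemma D_carrier [simp]: "D \<in> carrier_mat m m"
  unfolding D_def by (rule carrier_matI) auto

lemma det_D: "det D \<noteq> 0"
  using det_input_rows unfolding D_def .

lemma row_D:
  assumes "a < m"
  shows "row D a = (A ^\<^sub>m (k a - 1) * B)\<^sup>T *\<^sub>v c a"
proof -
  have "(A ^\<^sub>m (k a - 1) * B)\<^sup>T *\<^sub>v c a \<in> carrier_vec m"
    using B by (intro carrier_vecI) simp
  then show ?thesis
    unfolding D_def using assms by (subst mat_of_rows_row) simp_all
qed

lemma C'_carrier [simp]: "C' \<in> carrier_mat m n"
  unfolding C'_def by (rule carrier_matI) auto

lemma transpose_mult_coord:
  assumes "a < m" and M: "M \<in> carrier_mat n nc"
  shows "M\<^sup>T *\<^sub>v coord a s = (A ^\<^sub>m s * M)\<^sup>T *\<^sub>v c a"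
proof -
  have "(A ^\<^sub>m s * M)\<^sup>T = M\<^sup>T * (A ^\<^sub>m s)\<^sup>T"
    using A M by (intro transpose_mult[of _ n n]) auto
  then show ?thesis
    unfolding coord_def using A M c[OF assms(1)]
    by (simp add: assoc_mult_mat_vec[of _ nc n _ n])
qed

lemma coord_scalar_mult:
  assumes "a < m" and M: "M \<in> carrier_mat n nc" and v: "v \<in> carrier_vec nc"
  shows "coord a s \<bullet> (M *\<^sub>v v) = ((A ^\<^sub>m s * M)\<^sup>T *\<^sub>v c a) \<bullet> v"
  using transpose_vec_mult_scalar[OF M v coord_carrier[OF assms(1)], of s]
    transpose_mult_coord[OF assms(1) M, of s] by simp

text \<open>The coordinate \<open>(a, s)\<close> first feels an input \<open>k a - 1 - s\<close> steps after it was applied, and it then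
feels it through row \<open>a\<close> of \<open>D\<close>.\<close>

lemma coord_scalar_pow_input:
  assumes "a < m" and u: "u \<in> carrier_vec m" and le: "s + t < k a"
  shows "coord a s \<bullet> (A ^\<^sub>m t *\<^sub>v (B *\<^sub>v u)) = (if s + t + 1 = k a then (D *\<^sub>v u) $ a else 0)"
proof -
  have "coord a s \<bullet> (A ^\<^sub>m t *\<^sub>v (B *\<^sub>v u)) = coord a s \<bullet> ((A ^\<^sub>m t * B) *\<^sub>v u)"
    using A B u by (subst assoc_mult_mat_vec[of _ n n _ m]) auto
  also have "\<dots> = ((A ^\<^sub>m s * (A ^\<^sub>m t * B))\<^sup>T *\<^sub>v c a) \<bullet> u"
    using A B assms by (intro coord_scalar_mult) auto
  also have "A ^\<^sub>m s * (A ^\<^sub>m t * B) = A ^\<^sub>m (s + t) * B"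
    using A B by (subst assoc_mult_mat[symmetric, of _ n n _ n _ m]) (auto simp: pow_mat_add[OF A])
  also have "((A ^\<^sub>m (s + t) * B)\<^sup>T *\<^sub>v c a) \<bullet> u = (if s + t + 1 = k a then (D *\<^sub>v u) $ a else 0)"
  proof (cases "s + t + 1 = k a")
    case True
    then have "s + t = k a - 1" by simp
    then show ?thesis
      using True assms row_D[OF assms(1)] carrier_matD[OF D_carrier] by simp
  next
    case False
    then show ?thesis
      using assms no_early_input[of a "s + t"] by simp
  qed
  finally show ?thesis .
qed

lemma coord_scalar_reach:
  assumes a: "a < m" and v: "v \<in> reach t" and "s + t < k a"
  shows "coord a s \<bullet> v = 0"
proof (rule scalar_prod_span_eq_0[OF ctrb_cols_carrier coord_carrier[OF a] _ v[unfolded reach_def]])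
  fix y assume "y \<in> ctrb_col A B ` ({..<t} \<times> {..<m})"
  then obtain i j where ij: "i < t" "j < m" "y = A ^\<^sub>m i *\<^sub>v col B j"
    by (auto simp: ctrb_col_def)
  have "col B j = B *\<^sub>v unit_vec m j"
    using B ij by (simp add: mult_mat_unit_vec)
  then show "coord a s \<bullet> y = 0"
    using coord_scalar_pow_input[OF a, of "unit_vec m j" s i] ij assms by simp
qed

text \<open>Inputs can be chosen one at a time. The input applied \<open>t\<close> steps ago fixes the coordinates with
\<open>s + t + 1 = k a\<close>, does not touch those with smaller \<open>s\<close>, and disturbs those with larger \<open>s\<close> in a known way; the more
recent inputs then correct the disturbance, which is why the induction hypothesis is needed for all \<open>f\<close>.\<close>

lemma reach_realises_coords:
  "\<exists>y \<in> reach t. \<forall>a<m. \<forall>s<k a. coord a s \<bullet> y = (if k a \<le> s + t then f a s else 0)"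
proof (induction t arbitrary: f)
  case 0
  have "0\<^sub>v n \<in> reach 0"
    unfolding reach_def using in_spanI[of "0\<^sub>v n" "\<lambda>_. 0" "{}"] by simp
  then show ?case
    by (intro bexI[of _ "0\<^sub>v n"]) auto
next
  case (Suc t)
  \<comment> \<open>If \<open>k a \<le> t\<close>, the subtraction truncates and the entry of \<open>w\<close> is a junk value. This is harmless:
    such an output has only coordinates with \<open>k a \<le> s + t\<close>, which the vector \<open>y\<close> below corrects.\<close>
  define w where "w = vec m (\<lambda>a. f a (k a - 1 - t))"
  define u where "u = mat_inv D *\<^sub>v w"
  have u: "u \<in> carrier_vec m"
    unfolding u_def w_def using mat_inv_invertible[OF D_carrier det_D] by auto
  have "D *\<^sub>v u = (D * mat_inv D) *\<^sub>v w"
    unfolding u_def w_def using mat_inv_invertible(2)[OF D_carrier det_D] D_carrier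
    by (subst assoc_mult_mat_vec[of _ m m _ m]) auto
  then have Du: "D *\<^sub>v u = w"
    using mat_inv_invertible(3)[OF D_carrier det_D] by (simp add: w_def)
  define z where "z = A ^\<^sub>m t *\<^sub>v (B *\<^sub>v u)"
  have z: "z \<in> reach (Suc t)"
    unfolding z_def by (rule pow_mult_input_in_reach[OF u])
  obtain y where y: "y \<in> reach t" and
    y_coord: "\<And>a s. a < m \<Longrightarrow> s < k a \<Longrightarrow>
      coord a s \<bullet> y = (if k a \<le> s + t then f a s - coord a s \<bullet> z else 0)"
    using Suc.IH[of "\<lambda>a s. f a s - coord a s \<bullet> z"] by blast
  have "coord a s \<bullet> (y + z) = (if k a \<le> s + Suc t then f a s else 0)"
    if as: "a < m" "s < k a" for a s
  proof -
    have "coord a s \<bullet> (y + z) = coord a s \<bullet> y + coord a s \<bullet> z"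
      using as reach_carrier[OF y] reach_carrier[OF z] by (simp add: scalar_prod_add_distrib[of _ n])
    also have "\<dots> = (if k a \<le> s + Suc t then f a s else 0)"
    proof (cases "k a \<le> s + t")
      case True
      then show ?thesis using y_coord[OF as] by simp
    next
      case False
      then have "coord a s \<bullet> z = (if s + t + 1 = k a then w $ a else 0)"
        unfolding z_def using coord_scalar_pow_input[OF as(1) u, of s t] Du by simp
      moreover have "w $ a = f a s" if "s + t + 1 = k a"
      proof -
        have "k a - 1 - t = s" using that by simp
        then show ?thesis using as by (simp add: w_def)
      qed
      ultimately show ?thesis
        using False y_coord[OF as] by auto
    qed
    finally show ?thesis .
  qed
  moreover have "y + z \<in> reach (Suc t)"
    using reach_add reach_mono[of t "Suc t"] y z by auto
  ultimately show ?case by blast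
qed

text \<open>The coordinates in the order of the rows of \<open>T\<close>.\<close>

definition positions :: "(nat \<times> nat) list" where
  "positions = concat (map (\<lambda>a. map (Pair a) [0..<k a]) [0..<m])"

lemma length_positions [simp]: "length positions = n"
  unfolding positions_def using sum_k
  by (simp add: length_concat comp_def interv_sum_list_conv_sum_set_nat atLeast0LessThan)

lemma distinct_positions: "distinct positions"
  unfolding positions_def
proof (rule distinct_concat)
  have "inj_on (\<lambda>a. map (Pair a) [0..<k a]) {..<m}"
  proof (rule inj_onI)
    fix a b assume ab: "a \<in> {..<m}" "b \<in> {..<m}" "map (Pair a) [0..<k a] = map (Pair b) [0..<k b]"
    have "(a, 0) \<in> set (map (Pair a) [0..<k a])"
      using ab(1) k_pos[of a] by auto
    then show "a = b"
      unfolding ab(3) by auto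
  qed
  then show "distinct (map (\<lambda>a. map (Pair a) [0..<k a]) [0..<m])"
    by (simp add: distinct_map atLeast0LessThan)
qed (auto simp: distinct_map inj_on_def)

lemma set_positions: "set positions = Sigma {..<m} (\<lambda>a. {..<k a})"
  unfolding positions_def by auto

lemma positions_nth:
  assumes "p < n" and "positions ! p = (a, s)"
  shows "a < m" "s < k a"
  using assms nth_mem[of p positions] set_positions by auto

lemma positions_inj:
  "p < n \<Longrightarrow> q < n \<Longrightarrow> positions ! p = positions ! q \<Longrightarrow> p = q"
  using nth_eq_iff_index_eq[OF distinct_positions] by simp

lemma T_alt: "T = mat_of_rows n (map (\<lambda>(a, s). coord a s) positions)"
  unfolding T_def positions_def by (simp add: map_concat comp_def)

lemma T_carrier [simp]: "T \<in> carrier_mat n n"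
  unfolding T_alt by (rule carrier_matI) auto

lemma T_mult_vec_index:
  assumes "p < n" and "positions ! p = (a, s)"
  shows "(T *\<^sub>v v) $ p = coord a s \<bullet> v"
  using assms positions_nth[OF assms] by (simp add: T_alt)

lemma T_realises:
  assumes w: "w \<in> carrier_vec n"
    and supp: "\<And>p a s. p < n \<Longrightarrow> positions ! p = (a, s) \<Longrightarrow> s + t < k a \<Longrightarrow> w $ p = 0"
  shows "\<exists>y \<in> reach t. T *\<^sub>v y = w"
proof -
  define f where "f a s = w $ (THE p. p < n \<and> positions ! p = (a, s))" for a s
  have f: "f a s = w $ p" if "p < n" "positions ! p = (a, s)" for p a s
  proof -
    have "(THE p. p < n \<and> positions ! p = (a, s)) = p"
      using that positions_inj by (intro the_equality) auto
    then show ?thesis by (simp add: f_def)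
  qed
  obtain y where y: "y \<in> reach t"
    and coord_y: "\<And>a s. a < m \<Longrightarrow> s < k a \<Longrightarrow> coord a s \<bullet> y = (if k a \<le> s + t then f a s else 0)"
    using reach_realises_coords[of t f] by blast
  have "T *\<^sub>v y = w"
  proof (rule eq_vecI)
    fix p assume "p < dim_vec w"
    then have p: "p < n" using w by simp
    obtain a s where as: "positions ! p = (a, s)" by force
    show "(T *\<^sub>v y) $ p = w $ p"
      using T_mult_vec_index[OF p as] coord_y[OF positions_nth[OF p as]] f[OF p as] supp[OF p as]
      by auto
  qed (use w carrier_matD[OF T_carrier] in simp)
  with y show ?thesis by blast
qed

lemma k_le: "a < m \<Longrightarrow> k a \<le> n"
  using sum_k member_le_sum[of a "{..<m}" k] by simp

text \<open>No length exceeds \<open>n\<close>, so within \<open>n\<close> steps every coordinate can be prescribed and \<open>T\<close> is onto.\<close>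

lemma det_T: "det T \<noteq> 0"
proof (rule surj_imp_det_nonzero[OF T_carrier])
  fix w :: "'a vec" assume w: "w \<in> carrier_vec n"
  have "\<exists>y \<in> reach n. T *\<^sub>v y = w"
  proof (rule T_realises[OF w])
    fix p a s assume "p < n" "positions ! p = (a, s)" "s + n < k a"
    then show "w $ p = 0"
      using k_le[OF positions_nth(1)] by fastforce
  qed
  then show "\<exists>v \<in> carrier_vec n. T *\<^sub>v v = w"
    using reach_carrier by blast
qed

lemma T_inj:
  assumes "x \<in> carrier_vec n" "y \<in> carrier_vec n" "T *\<^sub>v x = T *\<^sub>v y"
  shows "x = y"
proof -
  have *: "mat_inv T *\<^sub>v (T *\<^sub>v v) = v" if "v \<in> carrier_vec n" for v
    using mat_inv_invertible[OF T_carrier det_T] that T_carrier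
    by (subst assoc_mult_mat_vec[of _ n n _ n, symmetric]) auto
  show ?thesis
    using *[OF assms(1)] *[OF assms(2)] unfolding assms(3) by (rule trans[OF sym])
qed

lemma card_positions_below:
  "card {p. p < n \<and> (case positions ! p of (a, s) \<Rightarrow> k a \<le> s + t)} = (\<Sum>a<m. min t (k a))"
proof -
  let ?Q = "{p. p < n \<and> (case positions ! p of (a, s) \<Rightarrow> k a \<le> s + t)}"
  have "bij_betw ((!) positions) ?Q (Sigma {..<m} (\<lambda>a. {k a - t..<k a}))"
  proof (rule bij_betw_imageI)
    show "inj_on ((!) positions) ?Q"
      using positions_inj by (auto simp: inj_on_def)
    show "(!) positions ` ?Q = Sigma {..<m} (\<lambda>a. {k a - t..<k a})"
    proof (intro equalityI subsetI)
      fix x assume "x \<in> (!) positions ` ?Q"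
      then show "x \<in> Sigma {..<m} (\<lambda>a. {k a - t..<k a})"
        using positions_nth by (cases x) fastforce
    next
      fix x assume x: "x \<in> Sigma {..<m} (\<lambda>a. {k a - t..<k a})"
      then have "x \<in> set positions"
        unfolding set_positions by auto
      then obtain p where "p < n" "positions ! p = x"
        by (auto simp: in_set_conv_nth)
      with x show "x \<in> (!) positions ` ?Q" by force
    qed
  qed
  then have "card ?Q = card (Sigma {..<m} (\<lambda>a. {k a - t..<k a}))"
    by (rule bij_betw_same_card)
  also have "\<dots> = (\<Sum>a<m. min t (k a))"
    by (auto intro!: sum.cong)
  finally show ?thesis .
qed

text \<open>The columns of \<open>T\<^sup>-\<^sup>1\<close> form the basis dual to the coordinates. Those that belong to coordinates with
\<open>k a \<le> s + t\<close> lie in \<open>reach t\<close> by \<open>reach_realises_coords\<close> and span it by \<open>coord_scalar_reach\<close>.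
Two bases of the same space have equally many elements.\<close>

lemma card_basis_reach:
  assumes S: "finite S" "lin_indpt S" "S \<subseteq> carrier_vec n" and span_S: "span S = reach t"
  shows "card S = (\<Sum>a<m. min t (k a))"
proof -
  let ?V = "mat_inv T"
  note V = mat_inv_invertible(2)[OF T_carrier det_T]
  define Q where "Q = {p. p < n \<and> (case positions ! p of (a, s) \<Rightarrow> k a \<le> s + t)}"
  have Q: "Q \<subseteq> {..<n}" "finite Q" unfolding Q_def by auto
  have T_col: "T *\<^sub>v col ?V p = unit_vec n p" if "p < n" for p
    using col_mult2[OF T_carrier V that] mat_inv_invertible(3)[OF T_carrier det_T] that by simp
  have col_inj: "inj_on (col ?V) {..<n}"
    by (rule inj_onI) (metis T_col lessThan_iff unit_vec_eq)
  define Y where "Y = col ?V ` Q"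
  have Y: "finite Y" "Y \<subseteq> carrier_vec n"
    unfolding Y_def using Q V by auto
  have card_Y: "card Y = (\<Sum>a<m. min t (k a))"
    unfolding Y_def using card_image[OF inj_on_subset[OF col_inj Q(1)]] card_positions_below
    by (simp add: Q_def)
  have "lin_indpt (set (cols ?V))"
  proof -
    have "det T * det ?V = 1"
      using det_mult[OF T_carrier V] mat_inv_invertible(3)[OF T_carrier det_T] by simp
    then show ?thesis
      using lin_dep_cols_imp_det_0[OF V] by auto
  qed
  moreover have "Y \<subseteq> set (cols ?V)"
    unfolding Y_def using Q V by (auto simp: cols_def)
  ultimately have Y_indpt: "lin_indpt Y"
    using subset_li_is_li by blast
  have "Y \<subseteq> reach t"
  proof
    fix y assume "y \<in> Y"
    then obtain p where p: "p \<in> Q" "y = col ?V p" unfolding Y_def by auto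
    then have pn: "p < n" using Q by auto
    have "\<exists>z \<in> reach t. T *\<^sub>v z = unit_vec n p"
      using p pn by (intro T_realises) (auto simp: Q_def)
    then obtain z where z: "z \<in> reach t" "T *\<^sub>v z = unit_vec n p" by blast
    have "z = y"
      using T_inj[OF reach_carrier[OF z(1)]] z T_col[OF pn] p V pn by auto
    then show "y \<in> reach t" using z by simp
  qed
  moreover have "reach t \<subseteq> span Y"
  proof
    fix v assume v: "v \<in> reach t"
    have vc: "v \<in> carrier_vec n" using reach_carrier[OF v] .
    have "v = ?V *\<^sub>v (T *\<^sub>v v)"
      using mat_inv_invertible(4)[OF T_carrier det_T] V vc T_carrier
      by (subst assoc_mult_mat_vec[of _ n n _ n, symmetric]) auto
    also have "\<dots> \<in> span Y"
      unfolding Y_def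
    proof (rule mult_mat_vec_in_span_support[OF V])
      fix p assume p: "p < n" "p \<notin> Q"
      obtain a s where as: "positions ! p = (a, s)" by force
      then show "(T *\<^sub>v v) $ p = 0"
        using p T_mult_vec_index[OF p(1) as] coord_scalar_reach[OF positions_nth(1)[OF p(1) as] v]
        by (auto simp: Q_def)
    qed (use Q mult_mat_vec_carrier[OF T_carrier vc] in auto)
    finally show "v \<in> span Y" .
  qed
  ultimately have "card Y \<le> card S" "card S \<le> card Y"
    using card_le_of_subset_span[of Y S] card_le_of_subset_span[of S Y] S Y Y_indpt
      span_S in_own_span[OF S(3)] by auto
  then show ?thesis using card_Y by simp
qed

end

section \<open>Controllability indices\<close>

text \<open>The indicator of \<open>y = x\<close> is the negative second difference in \<open>x\<close> of \<open>min x y\<close>, so the multiplicity of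
every value can be read off the given sums. Subtraction on \<open>nat\<close> truncates, hence the case
\<open>x = 0\<close>, where the indicator is \<open>1 - min 1 y\<close>.\<close>

lemma mset_map_eq_if_sum_min_eq:
  fixes f g :: "nat \<Rightarrow> nat"
  assumes "\<And>t. (\<Sum>a<m. min t (f a)) = (\<Sum>a<m. min t (g a))"
  shows "mset (map f [0..<m]) = mset (map g [0..<m])"
proof (rule multiset_eqI)
  fix x
  define F where "F t y = (if t = 0 then 1 - int (min 1 y)
      else 2 * int (min t y) - int (min (t - 1) y) - int (min (t + 1) y))" for t y
  have F: "F x y = (if y = x then 1 else 0)" for y
    unfolding F_def by auto
  have count: "int (count (mset (map h [0..<m])) x) = (\<Sum>a<m. F x (h a))" for h :: "nat \<Rightarrow> nat"
    unfolding F by (induction m) simp_all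
  have sum_F: "(\<Sum>a<m. F x (h a)) = (if x = 0 then int m - int (\<Sum>a<m. min 1 (h a))
      else 2 * int (\<Sum>a<m. min x (h a)) - int (\<Sum>a<m. min (x - 1) (h a))
        - int (\<Sum>a<m. min (x + 1) (h a)))" for h :: "nat \<Rightarrow> nat"
    unfolding F_def by (simp add: sum_subtractf sum_distrib_left)
  show "count (mset (map f [0..<m])) x = count (mset (map g [0..<m])) x"
    using count[of f] count[of g] unfolding sum_F assms by simp
qed

lemma downward_closed_eq_lessThan_card:
  fixes I :: "nat set"
  assumes "finite I" and "\<And>i. Suc i \<in> I \<Longrightarrow> i \<in> I"
  shows "I = {..<card I}"
proof -
  have down: "i \<in> I" if "j \<in> I" "i \<le> j" for i j
    using that(2,1) by (induction rule: inc_induct) (auto intro: assms(2))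
  show ?thesis
  proof (cases "I = {}")
    case False
    have "I = {..Max I}"
      using down[OF Max_in[OF assms(1) False]] Max_ge[OF assms(1)] by auto
    then have "I = {..<Suc (Max I)}"
      by (simp add: lessThan_Suc_atMost)
    then show ?thesis
      by (metis card_lessThan)
  qed simp
qed

context control_pair
begin

lemma span_insert_cong:
  assumes "S \<subseteq> carrier_vec n" "S' \<subseteq> carrier_vec n" "v \<in> carrier_vec n" and eq: "span S = span S'"
  shows "span (insert v S) = span (insert v S')"
proof -
  have "span (insert v X) \<subseteq> span (insert v Y)"
    if "X \<subseteq> carrier_vec n" "Y \<subseteq> carrier_vec n" "span X = span Y" for X Y
  proof (rule span_subsetI)
    have "X \<subseteq> span (insert v Y)"
      using in_own_span[OF that(1)] that(3) span_is_monotone[of Y "insert v Y"] by blast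
    moreover have "v \<in> span (insert v Y)"
      using in_own_span[of "insert v Y"] that(2) assms(3) by blast
    ultimately show "insert v X \<subseteq> span (insert v Y)"
      by blast
  qed (use that assms(3) in blast)
  from this[OF assms(1,2) eq] this[OF assms(2,1) eq[symmetric]] show ?thesis
    by (rule equalityI)
qed

lemma span_insert_redundant:
  assumes "S \<subseteq> carrier_vec n" "v \<in> span S"
  shows "span (insert v S) = span S"
proof (rule equalityI)
  show "span (insert v S) \<subseteq> span S"
    using in_own_span[OF assms(1)] assms(2) by (intro span_subsetI[OF assms(1)]) blast
qed (rule span_is_monotone, blast)

lemma mult_mat_vec_span:
  assumes M: "M \<in> carrier_mat n n" and S: "S \<subseteq> carrier_vec n" and v: "v \<in> span S"
  shows "M *\<^sub>v v \<in> span ((*\<^sub>v) M ` S)"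
proof -
  have MS: "(*\<^sub>v) M ` S \<subseteq> carrier_vec n"
    using M S mult_mat_vec_carrier by blast
  let ?N = "{w \<in> carrier_vec n. M *\<^sub>v w \<in> span ((*\<^sub>v) M ` S)}"
  have "0\<^sub>v n \<in> span ((*\<^sub>v) M ` S)"
    using in_spanI[of "0\<^sub>v n" "\<lambda>_. 0" "{}"] by simp
  moreover have "M *\<^sub>v 0\<^sub>v n = 0\<^sub>v n"
    using M by auto
  ultimately have "submodule class_ring ?N V"
    using M span_add1[OF MS] smult_in_span[OF MS] module_axioms
    by (auto simp: submodule_def mult_add_distrib_mat_vec[OF M] mult_mat_vec[OF M])
  moreover have "S \<subseteq> ?N"
    using S in_own_span[OF MS] by blast
  ultimately have "span S \<subseteq> ?N"
    using span_is_subset by blast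
  then show ?thesis using v by blast
qed

lemma lin_indpt_vecs_snoc:
  assumes "lin_indpt_vecs n us" and us: "set us \<subseteq> carrier_vec n" and v: "v \<in> carrier_vec n"
  shows "lin_indpt_vecs n (us @ [v]) \<longleftrightarrow> v \<notin> span (set us)"
proof (cases "v \<in> set us")
  case True
  then show ?thesis
    using in_own_span[OF us] by (auto simp: lin_indpt_vecs_def)
next
  case False
  then show ?thesis
    using assms lin_dep_iff_in_span[OF us _ v False] by (simp add: lin_indpt_vecs_def)
qed

lemma select_cols_append:
  "select_cols A B acc (xs @ ys) = select_cols A B (select_cols A B acc xs) ys"
  by (induction xs arbitrary: acc) auto

lemma select_cols_extends:
  "\<exists>zs. set zs \<subseteq> set ys \<and> select_cols A B acc ys = acc @ zs"
proof (induction ys arbitrary: acc)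
  case (Cons y ys)
  obtain zs where "set zs \<subseteq> set ys" "select_cols A B (acc @ [y]) ys = (acc @ [y]) @ zs"
    using Cons.IH[of "acc @ [y]"] by blast
  moreover obtain zs' where "set zs' \<subseteq> set ys" "select_cols A B acc ys = acc @ zs'"
    using Cons.IH[of acc] by blast
  ultimately show ?case
    by (cases "lin_indpt_vecs (dim_row A) (map (ctrb_col A B) (acc @ [y]))")
      (auto intro: exI[of _ "y # zs"] exI[of _ zs'])
qed simp

lemma select_cols_subset: "set (select_cols A B [] xs) \<subseteq> set xs"
  using select_cols_extends[of xs "[]"] by auto

text \<open>Keeping a column exactly when it enlarges the span keeps the selected columns independent and loses
nothing of the span.\<close>

lemma select_cols_indpt_span:
  assumes "snd ` set xs \<subseteq> {..<m}"
  shows "lin_indpt_vecs n (map (ctrb_col A B) (select_cols A B [] xs)) \<and>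
    span (ctrb_col A B ` set (select_cols A B [] xs)) = span (ctrb_col A B ` set xs)"
  using assms
proof (induction xs rule: rev_induct)
  case Nil
  then show ?case
    by (simp add: lin_indpt_vecs_def lin_dep_def)
next
  case (snoc x xs)
  let ?f = "ctrb_col A B" and ?s = "select_cols A B [] xs"
  have IH: "lin_indpt_vecs n (map ?f ?s)" "span (?f ` set ?s) = span (?f ` set xs)"
    using snoc by auto
  have carr: "?f y \<in> carrier_vec n" if "y \<in> set (xs @ [x])" for y
    using that snoc.prems by (intro ctrb_col_carrier') blast
  then have xs: "?f ` set xs \<subseteq> carrier_vec n" and x: "?f x \<in> carrier_vec n" by auto
  have s: "?f ` set ?s \<subseteq> carrier_vec n"
    using select_cols_subset[of xs] xs by blast
  have step: "select_cols A B [] (xs @ [x])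
      = (if lin_indpt_vecs n (map ?f ?s @ [?f x]) then ?s @ [x] else ?s)"
    using A by (simp add: select_cols_append)
  have iff: "lin_indpt_vecs n (map ?f ?s @ [?f x]) \<longleftrightarrow> ?f x \<notin> span (?f ` set xs)"
    using lin_indpt_vecs_snoc[OF IH(1) _ x] s IH(2) by simp
  show ?case
  proof (cases "?f x \<in> span (?f ` set xs)")
    case True
    then have "span (?f ` set (xs @ [x])) = span (?f ` set xs)"
      using span_insert_redundant[OF xs] by simp
    then show ?thesis
      unfolding step iff using True IH by simp
  next
    case False
    have "span (?f ` set (?s @ [x])) = span (?f ` set (xs @ [x]))"
      using span_insert_cong[OF s xs x IH(2)] by simp
    then show ?thesis
      unfolding step using iff False by simp
  qed
qed

text \<open>Because the selected columns span the same space as all columns scanned so far, the decision about a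
column can be phrased without reference to earlier decisions.\<close>

lemma mem_select_cols_iff:
  assumes "snd ` set (xs @ x # ys) \<subseteq> {..<m}" and "distinct (xs @ x # ys)"
  shows "x \<in> set (select_cols A B [] (xs @ x # ys)) \<longleftrightarrow>
    ctrb_col A B x \<notin> span (ctrb_col A B ` set xs)"
proof -
  let ?f = "ctrb_col A B" and ?s = "select_cols A B [] xs"
  have s: "lin_indpt_vecs n (map ?f ?s)" "span (?f ` set ?s) = span (?f ` set xs)"
    using select_cols_indpt_span[of xs] assms(1) by auto
  have carr: "?f y \<in> carrier_vec n" if "y \<in> set (xs @ [x])" for y
    using that assms(1) by (intro ctrb_col_carrier') auto
  have carr_s: "set (map ?f ?s) \<subseteq> carrier_vec n"
    using carr select_cols_subset[of xs] by force
  have "lin_indpt_vecs n (map ?f ?s @ [?f x]) \<longleftrightarrow> ?f x \<notin> span (?f ` set xs)"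
    using lin_indpt_vecs_snoc[OF s(1) carr_s carr[of x]] s(2) by simp
  then have step: "select_cols A B [] (xs @ x # ys)
      = select_cols A B (if ?f x \<notin> span (?f ` set xs) then ?s @ [x] else ?s) ys"
    using A by (simp add: select_cols_append)
  have "x \<notin> set ?s" "x \<notin> set ys"
    using assms(2) select_cols_subset[of xs] by auto
  then show ?thesis
    unfolding step
    using select_cols_extends[of ys "?s @ [x]"] select_cols_extends[of ys ?s] by auto
qed

definition selected :: "(nat \<times> nat) list" where
  "selected = select_cols A B [] (List.product [0..<n] [0..<m])"

lemma product_split:
  "t \<le> n \<Longrightarrow> List.product [0..<n] [0..<m]
    = List.product [0..<t] [0..<m] @ List.product [t..<n] [0..<m]"
  using upt_add_eq_append[of 0 t "n - t"] by (simp add: product_concat_map)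

lemma card_selected_below:
  assumes "t \<le> n"
  shows "\<exists>S. finite S \<and> lin_indpt S \<and> S \<subseteq> carrier_vec n \<and> span S = reach t \<and>
    card {x \<in> set selected. fst x < t} = card S"
proof -
  let ?f = "ctrb_col A B" and ?xs = "List.product [0..<t] [0..<m]"
  let ?s = "select_cols A B [] ?xs"
  have xs: "set ?xs = {..<t} \<times> {..<m}" by auto
  have s: "distinct (map ?f ?s)" "lin_indpt (?f ` set ?s)" "span (?f ` set ?s) = reach t"
    using select_cols_indpt_span[of ?xs] unfolding xs reach_def by (auto simp: lin_indpt_vecs_def)
  have "{x \<in> set selected. fst x < t} = set ?s"
    using select_cols_extends[of "List.product [t..<n] [0..<m]" ?s] select_cols_subset[of ?xs]
    unfolding selected_def product_split[OF assms] select_cols_append by fastforce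
  moreover have "card (set ?s) = card (?f ` set ?s)"
    using s(1) by (simp add: distinct_map card_image)
  moreover have "?f ` set ?s \<subseteq> carrier_vec n"
    using select_cols_subset[of ?xs] unfolding xs by fastforce
  ultimately show ?thesis
    using s by (intro exI[of _ "?f ` set ?s"]) auto
qed

lemma distinct_selected: "distinct selected"
proof -
  have "snd ` set (List.product [0..<n] [0..<m]) \<subseteq> {..<m}"
    by auto
  from select_cols_indpt_span[OF this] show ?thesis
    unfolding selected_def lin_indpt_vecs_def by (simp add: distinct_map)
qed

lemma set_selected: "set selected \<subseteq> {..<n} \<times> {..<m}"
  using select_cols_subset[of "List.product [0..<n] [0..<m]"] unfolding selected_def by auto

lemma mem_selected_iff:
  assumes "i < n" "j < m"
  shows "(i, j) \<in> set selected \<longleftrightarrow>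
    ctrb_col A B (i, j) \<notin> span (ctrb_col A B ` ({..<i} \<times> {..<m} \<union> {i} \<times> {..<j}))"
proof -
  have j: "[0..<m] = [0..<j] @ j # [Suc j..<m]"
    using assms(2) upt_add_eq_append[of 0 j "m - j"] by (simp add: upt_conv_Cons)
  have i: "[i..<n] = i # [Suc i..<n]"
    using assms(1) by (simp add: upt_conv_Cons)
  let ?pre = "List.product [0..<i] [0..<m] @ map (Pair i) [0..<j]"
  let ?post = "map (Pair i) [Suc j..<m] @ List.product [Suc i..<n] [0..<m]"
  have "List.product [i..<n] [0..<m]
      = map (Pair i) ([0..<j] @ j # [Suc j..<m]) @ List.product [Suc i..<n] [0..<m]"
    unfolding i j[symmetric] by simp
  then have split: "List.product [0..<n] [0..<m] = ?pre @ (i, j) # ?post"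
    using product_split[of i] assms(1) by simp
  have "distinct (?pre @ (i, j) # ?post)"
    unfolding split[symmetric] by (intro distinct_product) auto
  moreover have "snd ` set (?pre @ (i, j) # ?post) \<subseteq> {..<m}"
    unfolding split[symmetric] by auto
  moreover have "set ?pre = {..<i} \<times> {..<m} \<union> {i} \<times> {..<j}"
    by auto
  ultimately show ?thesis
    using mem_select_cols_iff[of ?pre "(i, j)" ?post] unfolding selected_def split by simp
qed

text \<open>If \<open>A\<^sup>i b\<^sub>j\<close> depends on the columns to its left, then multiplying the dependence by \<open>A\<close> shows that
\<open>A\<^bsup>i + 1\<^esup> b\<^sub>j\<close> depends on the columns to its left. So the powers selected for each \<open>b\<^sub>j\<close> form an initial segment.\<close>

lemma selected_downward_closed:
  assumes "(Suc i, j) \<in> set selected"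
  shows "(i, j) \<in> set selected"
proof (rule ccontr)
  have ij: "Suc i < n" "j < m"
    using assms set_selected by auto
  let ?f = "ctrb_col A B"
  let ?before = "\<lambda>i. {..<i} \<times> {..<m} \<union> {i} \<times> {..<j}"
  have carr: "?f ` ?before l \<subseteq> carrier_vec n" for l
    using ij by auto
  have shift: "A *\<^sub>v ?f (l, b) = ?f (Suc l, b)" if "b < m" for l b
    using A B that pow_mat_add[OF A, of 1 l]
    by (simp add: ctrb_col_def assoc_mult_mat_vec[of A n n "A ^\<^sub>m l" n])
  assume "(i, j) \<notin> set selected"
  then have "?f (i, j) \<in> span (?f ` ?before i)"
    using mem_selected_iff[of i j] ij by simp
  then have "?f (Suc i, j) \<in> span ((*\<^sub>v) A ` ?f ` ?before i)"
    using mult_mat_vec_span[OF A carr] shift[OF ij(2)] by metis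
  moreover have "(*\<^sub>v) A ` ?f ` ?before i \<subseteq> ?f ` ?before (Suc i)"
  proof
    fix v assume "v \<in> (*\<^sub>v) A ` ?f ` ?before i"
    then obtain l b where lb: "(l, b) \<in> ?before i" "v = A *\<^sub>v ?f (l, b)" by auto
    then have "b < m" using ij by auto
    then have "v = ?f (Suc l, b)" using lb shift by simp
    moreover have "(Suc l, b) \<in> ?before (Suc i)" using lb by auto
    ultimately show "v \<in> ?f ` ?before (Suc i)" by blast
  qed
  ultimately have "?f (Suc i, j) \<in> span (?f ` ?before (Suc i))"
    using span_is_monotone by blast
  then show False
    using mem_selected_iff[of "Suc i" j] ij assms by simp
qed

text \<open>The controllability indices in the order of the input columns, before sorting.\<close>

definition index :: "nat \<Rightarrow> nat" where
  "index j = length (filter (\<lambda>x. snd x = j) selected)"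

lemma mem_selected_iff_less_index:
  assumes "j < m"
  shows "(i, j) \<in> set selected \<longleftrightarrow> i < index j"
proof -
  let ?I = "{i. (i, j) \<in> set selected}"
  have "?I \<subseteq> {..<n}"
    using set_selected by auto
  then have fin: "finite ?I"
    using finite_subset by blast
  have "bij_betw (\<lambda>i. (i, j)) ?I {x \<in> set selected. snd x = j}"
    by (auto simp: bij_betw_def inj_on_def)
  then have "card ?I = card {x \<in> set selected. snd x = j}"
    by (rule bij_betw_same_card)
  also have "\<dots> = index j"
    using distinct_card[OF distinct_filter[OF distinct_selected]] by (simp add: index_def)
  finally have "?I = {..<index j}"
    using downward_closed_eq_lessThan_card[OF fin] selected_downward_closed by auto
  then show ?thesis by blast
qed

lemma index_le: "j < m \<Longrightarrow> index j \<le> n"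
  using mem_selected_iff_less_index[of j "index j - 1"] set_selected
  by (cases "index j") auto

lemma controllability_indices_eq:
  "controllability_indices A B = rev (sort (map index [0..<m]))"
  using A B by (simp add: controllability_indices_def Let_def index_def[abs_def] selected_def)

lemma sum_min_index:
  "(\<Sum>j<m. min t (index j)) = card {x \<in> set selected. fst x < t}"
proof -
  have "{x \<in> set selected. fst x < t} = (\<lambda>(j, i). (i, j)) ` Sigma {..<m} (\<lambda>j. {..<min t (index j)})"
    using mem_selected_iff_less_index set_selected by (auto simp: image_iff)
  then have "card {x \<in> set selected. fst x < t} = card (Sigma {..<m} (\<lambda>j. {..<min t (index j)}))"
    by (simp add: card_image inj_on_def split_def prod_eq_iff)
  then show ?thesis by simp
qed

end

context flat_outputs
begin

text \<open>Both sides of the multiset comparison count a basis of \<open>reach t\<close>. For \<open>t > n\<close> the sums do not change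
any more, because neither the indices nor the lengths exceed \<open>n\<close>.\<close>

theorem controllability_indices_eq_lengths:
  assumes "sorted (rev (map k [0..<m]))"
  shows "controllability_indices A B = map k [0..<m]"
proof -
  have below: "(\<Sum>j<m. min t (index j)) = (\<Sum>a<m. min t (k a))" if "t \<le> n" for t
    using card_selected_below[OF that] card_basis_reach sum_min_index by auto
  have "(\<Sum>j<m. min t (index j)) = (\<Sum>a<m. min t (k a))" for t
  proof (cases "t \<le> n")
    case False
    then have "min t x = min n x" if "x \<le> n" for x
      using that by simp
    then have "(\<Sum>j<m. min t (index j)) = (\<Sum>j<m. min n (index j))"
      and "(\<Sum>a<m. min n (k a)) = (\<Sum>a<m. min t (k a))"
      using index_le k_le by simp_all
    then show ?thesis using below[of n] by simp
  qed (rule below)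
  then have "mset (map index [0..<m]) = mset (rev (map k [0..<m]))"
    using mset_map_eq_if_sum_min_eq[where m = m and f = index and g = k] by simp
  then have "sort (map index [0..<m]) = rev (map k [0..<m])"
    using properties_for_sort[OF _ assms] by metis
  then show ?thesis
    unfolding controllability_indices_eq by simp
qed

end

context flat_outputs
begin

section \<open>Reduction to Brunovsky form\<close>

lemma transpose_A_coord: "a < m \<Longrightarrow> A\<^sup>T *\<^sub>v coord a s = coord a (Suc s)"
  using transpose_mult_coord[OF _ A] by (simp add: coord_def)

lemma transpose_B_coord:
  assumes "a < m" "s < k a"
  shows "B\<^sup>T *\<^sub>v coord a s = (if Suc s = k a then row D a else 0\<^sub>v m)"
proof (cases "Suc s = k a")
  case True
  then have "k a - 1 = s" by simp
  then show ?thesis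
    using True assms transpose_mult_coord[OF assms(1) B] row_D by simp
next
  case False
  then show ?thesis
    using assms transpose_mult_coord[OF assms(1) B] no_early_input[of a s] by simp
qed

lemma T_B: "T * B = brunovsky_B (map k [0..<m]) * D"
proof -
  have "T * B = mat_of_rows m (map (\<lambda>u. B\<^sup>T *\<^sub>v u)
      (concat (map (\<lambda>a. map (coord a) [0..<k a]) [0..<m])))"
    unfolding T_def using B by (intro mat_of_rows_mult) auto
  also have "map (\<lambda>u. B\<^sup>T *\<^sub>v u) (concat (map (\<lambda>a. map (coord a) [0..<k a]) [0..<m]))
      = concat (map (\<lambda>a. replicate (k a - 1) (0\<^sub>v m) @ [row D a]) [0..<m])"
    unfolding map_concat map_map comp_def
  proof (intro arg_cong[of _ _ concat] map_cong refl)
    fix a assume "a \<in> set [0..<m]"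
    then have a: "a < m" "1 \<le> k a" using k_pos by auto
    then show "map (\<lambda>s. B\<^sup>T *\<^sub>v coord a s) [0..<k a] = replicate (k a - 1) (0\<^sub>v m) @ [row D a]"
      using transpose_B_coord[OF a(1)] by (intro nth_equalityI) (auto simp: nth_append)
  qed
  also have "\<dots> = concat (map (\<lambda>(k, u). replicate (k - 1) (0\<^sub>v m) @ [u])
      (map (\<lambda>a. (k a, row D a)) [0..<m]))"
    by (simp add: comp_def)
  also have "mat_of_rows m \<dots> = brunovsky_B (map fst (map (\<lambda>a. (k a, row D a)) [0..<m]))
      * mat_of_rows m (map snd (map (\<lambda>a. (k a, row D a)) [0..<m]))"
    using k_pos by (intro brunovsky_B_mult[symmetric]) auto
  also have "map snd (map (\<lambda>a. (k a, row D a)) [0..<m]) = rows D"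
    using carrier_matD[OF D_carrier] by (simp add: comp_def rows_def)
  also have "mat_of_rows m (rows D) = D"
    using mat_of_rows_rows[of D] carrier_matD[OF D_carrier] by simp
  finally show ?thesis by (simp add: comp_def)
qed

definition F :: "'a mat" where
  "F = - mat_inv D * C'"

lemma F_carrier [simp]: "F \<in> carrier_mat m n"
  unfolding F_def using mat_inv_invertible(2)[OF D_carrier det_D] C'_carrier
  by (intro mult_carrier_mat[of _ m m]) auto

lemma D_F: "D * F = - C'"
proof -
  note V = mat_inv_invertible[OF D_carrier det_D]
  have "D * F = D * - mat_inv D * C'"
    unfolding F_def using V C'_carrier
    by (intro assoc_mult_mat[symmetric, of _ m m _ m _ n] D_carrier) auto
  also have "D * - mat_inv D = - (D * mat_inv D)"
    using V carrier_matD[OF D_carrier] by (intro uminus_mult_right_mat) auto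
  also have "\<dots> * C' = - (1\<^sub>m m * C')"
    unfolding V(3) using carrier_matD[OF C'_carrier] by (intro uminus_mult_left_mat) auto
  finally show ?thesis using C'_carrier by simp
qed

lemma transpose_F_row_D:
  assumes "a < m"
  shows "F\<^sup>T *\<^sub>v row D a = - coord a (k a)"
proof -
  have "F\<^sup>T *\<^sub>v row D a = rows (D * F) ! a"
    using rows_mult[OF D_carrier F_carrier] carrier_matD[OF D_carrier] assms by simp
  also have "\<dots> = - row C' a"
    unfolding D_F using carrier_matD[OF C'_carrier] assms by simp
  also have "row C' a = coord a (k a)"
    unfolding C'_def using assms by simp
  finally show ?thesis .
qed

text \<open>The feedback leaves the coordinates of a chain alone except for the last one, where it cancels
\<open>c\<^sub>a A\<^bsup>k\<^sub>a\<^esup>\<close> because \<open>D F = -C'\<close>.\<close>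

lemma transpose_closed_loop_coord:
  assumes "a < m" "s < k a"
  shows "(A + B * F)\<^sup>T *\<^sub>v coord a s = (if Suc s = k a then 0\<^sub>v n else coord a (Suc s))"
proof -
  have c: "coord a s \<in> carrier_vec n" "coord a (Suc s) \<in> carrier_vec n"
    using assms(1) by simp_all
  have "(A + B * F)\<^sup>T = A\<^sup>T + F\<^sup>T * B\<^sup>T"
    using transpose_add[OF A mult_carrier_mat[OF B F_carrier]] transpose_mult[OF B F_carrier] by simp
  then have "(A + B * F)\<^sup>T *\<^sub>v coord a s = A\<^sup>T *\<^sub>v coord a s + (F\<^sup>T * B\<^sup>T) *\<^sub>v coord a s"
    using add_mult_distrib_mat_vec[of "A\<^sup>T" n n "F\<^sup>T * B\<^sup>T" "coord a s"] A B c F_carrier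
      mult_carrier_mat[of "F\<^sup>T" n m "B\<^sup>T" n] by (simp only: transpose_carrier_mat)
  also have "(F\<^sup>T * B\<^sup>T) *\<^sub>v coord a s = F\<^sup>T *\<^sub>v (B\<^sup>T *\<^sub>v coord a s)"
    using B c F_carrier by (intro assoc_mult_mat_vec[of _ n m _ n]) auto
  also have "A\<^sup>T *\<^sub>v coord a s + \<dots> = (if Suc s = k a then 0\<^sub>v n else coord a (Suc s))"
  proof (cases "Suc s = k a")
    case True
    then show ?thesis
      using transpose_A_coord[OF assms(1), of s] transpose_B_coord[OF assms] c
        transpose_F_row_D[OF assms(1)] by simp
  next
    case False
    have "F\<^sup>T *\<^sub>v 0\<^sub>v m = 0\<^sub>v n"
      using carrier_matD[OF F_carrier] by (intro eq_vecI) auto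
    then show ?thesis
      using False transpose_A_coord[OF assms(1), of s] transpose_B_coord[OF assms] c by simp
  qed
  finally show ?thesis .
qed

lemma T_closed_loop: "T * (A + B * F) = brunovsky_A (map k [0..<m]) * T"
proof -
  let ?rss = "map (\<lambda>a. map (coord a) [0..<k a]) [0..<m]"
  have M: "A + B * F \<in> carrier_mat n n"
    using A B F_carrier by simp
  have "T * (A + B * F) = mat_of_rows n (map (\<lambda>u. (A + B * F)\<^sup>T *\<^sub>v u) (concat ?rss))"
    unfolding T_def by (intro mat_of_rows_mult M) auto
  also have "map (\<lambda>u. (A + B * F)\<^sup>T *\<^sub>v u) (concat ?rss)
      = concat (map (\<lambda>rs. tl rs @ [0\<^sub>v n]) ?rss)"
    unfolding map_concat map_map comp_def
  proof (intro arg_cong[of _ _ concat] map_cong refl)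
    fix a assume "a \<in> set [0..<m]"
    then have a: "a < m" "1 \<le> k a" using k_pos by auto
    then show "map (\<lambda>s. (A + B * F)\<^sup>T *\<^sub>v coord a s) [0..<k a]
        = tl (map (coord a) [0..<k a]) @ [0\<^sub>v n]"
      using transpose_closed_loop_coord[OF a(1)]
      by (intro nth_equalityI) (auto simp: nth_append nth_tl)
  qed
  also have "mat_of_rows n \<dots> = brunovsky_A (map length ?rss) * mat_of_rows n (concat ?rss)"
    using k_pos by (intro brunovsky_A_mult[symmetric]) fastforce
  finally show ?thesis
    unfolding T_def by (simp add: comp_def)
qed

theorem brunovsky_form:
  shows "T * (A + B * F) * mat_inv T = brunovsky_A (map k [0..<m])"
    and "T * B * mat_inv D = brunovsky_B (map k [0..<m])"
proof -
  have sum: "sum_list (map k [0..<m]) = n"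
    using sum_k by (simp add: interv_sum_list_conv_sum_set_nat atLeast0LessThan)
  have bA: "brunovsky_A (map k [0..<m]) \<in> carrier_mat n n"
    and bB: "brunovsky_B (map k [0..<m]) \<in> carrier_mat n m"
    using brunovsky_A_carrier[of "map k [0..<m]"] brunovsky_B_carrier[of "map k [0..<m]"]
    unfolding sum by (simp_all del: brunovsky_A_carrier brunovsky_B_carrier)
  show "T * (A + B * F) * mat_inv T = brunovsky_A (map k [0..<m])"
    unfolding T_closed_loop using mat_inv_invertible[OF T_carrier det_T] bA
    by (simp add: assoc_mult_mat[OF bA T_carrier] right_mult_one_mat[OF bA])
  show "T * B * mat_inv D = brunovsky_B (map k [0..<m])"
    unfolding T_B using mat_inv_invertible[OF D_carrier det_D] bB
    by (simp add: assoc_mult_mat[OF bB D_carrier] right_mult_one_mat[OF bB])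
qed

end

section \<open>Staircase pairs\<close>

lemma hstack3:
  assumes "X \<in> carrier_mat r a" "Y \<in> carrier_mat r b" "Z \<in> carrier_mat r d"
  shows "hstack r [X, Y, Z] \<in> carrier_mat r (a + b + d)"
    and "l < r \<Longrightarrow> p < a + b + d \<Longrightarrow> hstack r [X, Y, Z] $$ (l, p)
      = (if p < a then X $$ (l, p) else if p < a + b then Y $$ (l, p - a) else Z $$ (l, p - a - b))"
proof -
  have dims: "dim_col X = a" "dim_col Y = b" "dim_col Z = d"
    "dim_row X = r" "dim_row Y = r" "dim_row Z = r"
    using assms by auto
  show "hstack r [X, Y, Z] \<in> carrier_mat r (a + b + d)"
    unfolding hstack_def by (rule carrier_matI) (simp_all add: dims)
  show "hstack r [X, Y, Z] $$ (l, p)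
      = (if p < a then X $$ (l, p) else if p < a + b then Y $$ (l, p - a) else Z $$ (l, p - a - b))"
    if "l < r" "p < a + b + d"
  proof -
    have "p - a < b \<longleftrightarrow> p < a + b" if "\<not> p < a"
      using that by linarith
    then show ?thesis
      using that by (auto simp add: hstack_def mat_of_cols_index nth_append dims)
  qed
qed

locale staircase_pair =
  fixes n m \<mu> :: nat and \<omega> :: "nat \<Rightarrow> nat" and A B :: "'a :: field mat"
  assumes staircase: "staircase_form n m \<mu> \<omega> A B" and n_pos: "1 \<le> n"
begin

lemma A: "A \<in> carrier_mat n n"
  and B: "B \<in> carrier_mat n m"
  and \<omega>_0: "\<omega> 0 = m"
  and \<omega>_1: "\<omega> 1 = m"
  and \<omega>_decreasing: "i \<in> {1..<\<mu>} \<Longrightarrow> \<omega> (i + 1) \<le> \<omega> i"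
  and \<omega>_pos: "i \<in> {1..\<mu>} \<Longrightarrow> 1 \<le> \<omega> i"
  and sum_\<omega>: "(\<Sum>i = 1..\<mu>. \<omega> i) = n"
  and A_block_0: "i \<in> {1..\<mu>} \<Longrightarrow> j \<in> {1..\<mu>} \<Longrightarrow> i > j + 1 \<Longrightarrow> block \<omega> A i j = 0\<^sub>m (\<omega> i) (\<omega> j)"
  and B_block_0: "i \<in> {2..\<mu>} \<Longrightarrow> block \<omega> B i 0 = 0\<^sub>m (\<omega> i) m"
  and rank_B: "vec_space.rank (\<omega> 1) (block \<omega> B 1 0) = \<omega> 1"
  and rank_A: "i \<in> {2..\<mu>} \<Longrightarrow> vec_space.rank (\<omega> i) (block \<omega> A i (i - 1)) = \<omega> i"
  using staircase unfolding staircase_form_def by auto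

lemma \<mu>_pos: "1 \<le> \<mu>"
  using sum_\<omega> n_pos by (cases \<mu>) auto

definition block_start :: "nat \<Rightarrow> nat" where
  "block_start i = (\<Sum>l = 1..<i. \<omega> l)"

lemma block_start_1 [simp]: "block_start (Suc 0) = 0"
  by (simp add: block_start_def)

lemma block_start_Suc: "1 \<le> i \<Longrightarrow> block_start (Suc i) = block_start i + \<omega> i"
  by (simp add: block_start_def)

lemma block_start_mono: "i \<le> j \<Longrightarrow> block_start i \<le> block_start j"
  unfolding block_start_def by (rule sum_mono2) auto

lemma block_start_end: "block_start (Suc \<mu>) = n"
  unfolding block_start_def sum_\<omega>[symmetric] by (simp add: atLeastLessThanSuc_atLeastAtMost)

lemma block_index_exists:
  assumes "p < n"
  obtains i where "i \<in> {1..\<mu>}" "block_start i \<le> p" "p < block_start (Suc i)"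
proof -
  have "\<exists>i. i \<in> {1..l} \<and> block_start i \<le> p \<and> p < block_start (Suc i)" if "p < block_start (Suc l)" for l
    using that
  proof (induction l)
    case (Suc l)
    show ?case
    proof (cases "p < block_start (Suc l)")
      case True
      then show ?thesis using Suc.IH by fastforce
    next
      case False
      then show ?thesis using Suc.prems by (intro exI[of _ "Suc l"]) auto
    qed
  qed simp
  then show thesis
    using assms that block_start_end by metis
qed

lemma block_index:
  "p < \<omega> i \<Longrightarrow> q < \<omega> j \<Longrightarrow> block \<omega> M i j $$ (p, q) = M $$ (block_start i + p, block_start j + q)"
  by (simp add: block_def block_start_def)

lemma block_carrier [simp]: "block \<omega> M i j \<in> carrier_mat (\<omega> i) (\<omega> j)"
  by (simp add: block_def)

text \<open>The zero blocks of the staircase form, transferred to entries by locating the blocks of the row and of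
the column.\<close>

lemma A_entry_eq_0:
  assumes "1 \<le> j" "block_start (Suc (Suc j)) \<le> p" "p < n" "q < block_start (Suc j)"
  shows "A $$ (p, q) = 0"
proof -
  have "q < n"
  proof (rule ccontr)
    assume "\<not> q < n"
    with assms have "block_start (Suc j) > block_start (Suc \<mu>)" unfolding block_start_end by simp
    moreover have "block_start (Suc j) \<le> block_start (Suc (Suc j))" by (rule block_start_mono) simp
    ultimately show False using assms block_start_end by simp
  qed
  then obtain j' where j': "j' \<in> {1..\<mu>}" "block_start j' \<le> q" "q < block_start (Suc j')"
    by (rule block_index_exists)
  obtain i where i: "i \<in> {1..\<mu>}" "block_start i \<le> p" "p < block_start (Suc i)"
    using assms(3) by (rule block_index_exists)
  have "j' \<le> j"
    using block_start_mono[of "Suc j" j'] j' assms(4) by (cases "j' \<le> j") auto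
  moreover have "j + 2 \<le> i"
    using block_start_mono[of "Suc i" "Suc (Suc j)"] i assms(2) by (cases "j + 2 \<le> i") auto
  ultimately have "block \<omega> A i j' = 0\<^sub>m (\<omega> i) (\<omega> j')"
    using A_block_0 i j' by simp
  moreover have "p - block_start i < \<omega> i" "q - block_start j' < \<omega> j'"
    using i j' block_start_Suc by auto
  ultimately show ?thesis
    using block_index[of "p - block_start i" i "q - block_start j'" j' A] i j' by simp
qed

text \<open>The vectors supported in the first \<open>i\<close> blocks.\<close>

definition lead :: "nat \<Rightarrow> 'a vec set" where
  "lead i = {v \<in> carrier_vec n. \<forall>p<n. block_start (Suc i) \<le> p \<longrightarrow> v $ p = 0}"

definition vec_block :: "nat \<Rightarrow> 'a vec \<Rightarrow> 'a vec" where
  "vec_block i v = vec (\<omega> i) (\<lambda>q. v $ (block_start i + q))"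

lemma vec_block_carrier [simp]: "vec_block i v \<in> carrier_vec (\<omega> i)"
  by (simp add: vec_block_def)

lemma lead_carrier: "v \<in> lead i \<Longrightarrow> v \<in> carrier_vec n"
  by (simp add: lead_def)

lemma lead_mono: "i \<le> j \<Longrightarrow> lead i \<subseteq> lead j"
  using block_start_mono[of "Suc i" "Suc j"] unfolding lead_def by auto

lemma lead_all: "lead \<mu> = carrier_vec n"
  unfolding lead_def block_start_end by auto

lemma lead_0: "v \<in> lead 0 \<Longrightarrow> v = 0\<^sub>v n"
  unfolding lead_def by auto

lemma lead_pred:
  assumes "1 \<le> i" "v \<in> lead i" "vec_block i v = 0\<^sub>v (\<omega> i)"
  shows "v \<in> lead (i - 1)"
proof -
  have "v $ p = 0" if p: "p < n" "block_start i \<le> p" for p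
  proof (cases "block_start (Suc i) \<le> p")
    case False
    then have "p - block_start i < \<omega> i" using p block_start_Suc[OF assms(1)] by simp
    then have "v $ p = vec_block i v $ (p - block_start i)" using p by (simp add: vec_block_def)
    then show ?thesis using \<open>p - block_start i < \<omega> i\<close> assms(3) by simp
  qed (use p assms(2) in \<open>simp add: lead_def\<close>)
  then show ?thesis
    using assms(1,2) by (simp add: lead_def)
qed

lemma vec_block_eq_0:
  assumes "v \<in> lead (i - 1)" "i \<in> {1..\<mu>}"
  shows "vec_block i v = 0\<^sub>v (\<omega> i)"
proof (rule eq_vecI)
  fix q assume "q < dim_vec (0\<^sub>v (\<omega> i) :: 'a vec)"
  then have q: "q < \<omega> i" by simp
  have "block_start i + q < n"
    using q block_start_Suc[of i] block_start_mono[of "Suc i" "Suc \<mu>"] assms(2) block_start_end by simp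
  then show "vec_block i v $ q = 0\<^sub>v (\<omega> i) $ q"
    using q assms by (simp add: vec_block_def lead_def)
qed (simp add: vec_block_def)

lemma A_mult_lead:
  assumes v: "v \<in> lead i" and "1 \<le> i"
  shows "A *\<^sub>v v \<in> lead (Suc i)"
proof -
  have "(A *\<^sub>v v) $ p = 0" if p: "p < n" "block_start (Suc (Suc i)) \<le> p" for p
  proof -
    have "(A *\<^sub>v v) $ p = (\<Sum>q = 0..<n. A $$ (p, q) * v $ q)"
      using p A lead_carrier[OF v] by (simp add: scalar_prod_def)
    also have "\<dots> = 0"
    proof (rule sum.neutral, rule ballI)
      fix q assume "q \<in> {0..<n}"
      then show "A $$ (p, q) * v $ q = 0"
        using A_entry_eq_0[OF assms(2) p(2,1), of q] v
        by (cases "q < block_start (Suc i)") (auto simp: lead_def)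
    qed
    finally show ?thesis .
  qed
  then show ?thesis
    using v A mult_mat_vec_carrier[OF A] by (simp add: lead_def)
qed

text \<open>On \<open>lead i\<close> only the subdiagonal block contributes to block \<open>i + 1\<close> of the image.\<close>

lemma vec_block_A_mult:
  assumes v: "v \<in> lead i" and i: "1 \<le> i" "Suc i \<le> \<mu>"
  shows "vec_block (Suc i) (A *\<^sub>v v) = block \<omega> A (Suc i) i *\<^sub>v vec_block i v"
proof (rule eq_vecI)
  fix r assume "r < dim_vec (block \<omega> A (Suc i) i *\<^sub>v vec_block i v)"
  then have r: "r < \<omega> (Suc i)" by (simp add: block_def)
  let ?p = "block_start (Suc i) + r"
  have p: "?p < n"
    using r block_start_Suc[of "Suc i"] block_start_mono[of "Suc (Suc i)" "Suc \<mu>"] i block_start_end by simp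
  have le: "block_start (Suc i) \<le> n"
    using block_start_mono[of "Suc i" "Suc \<mu>"] i block_start_end by simp
  have zero: "A $$ (?p, q) * v $ q = 0" if q: "q < n" "q \<notin> {block_start i..<block_start (Suc i)}" for q
  proof (cases "block_start (Suc i) \<le> q")
    case True
    then show ?thesis using v q by (simp add: lead_def)
  next
    case False
    then have "q < block_start i" using q by auto
    moreover from this obtain j where j: "i = Suc j" "1 \<le> j"
      using i by (cases i; cases "i - 1") (auto simp: block_start_def)
    ultimately show ?thesis
      using A_entry_eq_0[of j ?p q] p by simp
  qed
  have "vec_block (Suc i) (A *\<^sub>v v) $ r = (\<Sum>q = 0..<n. A $$ (?p, q) * v $ q)"
    using r p A lead_carrier[OF v] by (simp add: vec_block_def scalar_prod_def)
  also have "\<dots> = (\<Sum>q = block_start i..<block_start (Suc i). A $$ (?p, q) * v $ q)"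
    using zero le by (intro sum.mono_neutral_right) auto
  also have "\<dots> = (\<Sum>q = 0..<\<omega> i. A $$ (?p, block_start i + q) * v $ (block_start i + q))"
    using block_start_Suc[OF i(1)] sum.shift_bounds_nat_ivl[of "\<lambda>q. A $$ (?p, q) * v $ q" 0 "block_start i" "\<omega> i"]
    by (simp add: add.commute)
  also have "\<dots> = (block \<omega> A (Suc i) i *\<^sub>v vec_block i v) $ r"
    using r carrier_matD[OF block_carrier[of A "Suc i" i]]
    by (simp add: scalar_prod_def vec_block_def block_index)
  finally show "vec_block (Suc i) (A *\<^sub>v v) $ r = (block \<omega> A (Suc i) i *\<^sub>v vec_block i v) $ r" .
qed (simp add: vec_block_def block_def)

lemma B_mult_lead:
  assumes u: "u \<in> carrier_vec m"
  shows "B *\<^sub>v u \<in> lead 1"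
proof -
  have "(B *\<^sub>v u) $ p = 0" if p: "p < n" "block_start 2 \<le> p" for p
  proof -
    obtain i where i: "i \<in> {1..\<mu>}" "block_start i \<le> p" "p < block_start (Suc i)"
      using p(1) by (rule block_index_exists)
    have "2 \<le> i"
      using block_start_mono[of "Suc i" 2] i p by (cases "2 \<le> i") auto
    then have zero: "block \<omega> B i 0 = 0\<^sub>m (\<omega> i) m"
      using i B_block_0 by simp
    have "B $$ (p, q) = 0" if "q < m" for q
      using block_index[of "p - block_start i" i q 0 B] zero i block_start_Suc[of i] that \<omega>_0
      by (simp add: block_start_def)
    then show ?thesis
      using p B u by (simp add: scalar_prod_def)
  qed
  then show ?thesis
    using mult_mat_vec_carrier[OF B u] by (simp add: lead_def numeral_2_eq_2)
qed

lemma input_in_lead: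
  assumes "u \<in> carrier_vec m"
  shows "A ^\<^sub>m i *\<^sub>v (B *\<^sub>v u) \<in> lead (Suc i)"
proof (induction i)
  case 0
  then show ?case
    using B_mult_lead[OF assms] mult_mat_vec_carrier[OF B assms] A by simp
next
  case (Suc i)
  have "A ^\<^sub>m Suc i = A * A ^\<^sub>m i"
    using pow_mat_add[OF A, of 1 i] A by simp
  then have "A ^\<^sub>m Suc i *\<^sub>v (B *\<^sub>v u) = A *\<^sub>v (A ^\<^sub>m i *\<^sub>v (B *\<^sub>v u))"
    using A mult_mat_vec_carrier[OF B assms] by (simp add: assoc_mult_mat_vec[of A n n _ n])
  then show ?case
    using A_mult_lead[OF Suc] by simp
qed

lemma input_eq_0:
  assumes u: "u \<in> carrier_vec m" and "B *\<^sub>v u = 0\<^sub>v n"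
  shows "u = 0\<^sub>v m"
proof -
  have blk: "block \<omega> B 1 0 \<in> carrier_mat m m"
    using block_carrier[of B 1 0] \<omega>_0 \<omega>_1 by simp
  have "m \<le> n"
    using block_start_mono[of 2 "Suc \<mu>"] block_start_Suc[of 1] \<omega>_1 block_start_end \<mu>_pos by (simp add: numeral_2_eq_2)
  have "block \<omega> B 1 0 *\<^sub>v u = 0\<^sub>v m"
  proof (rule eq_vecI)
    fix r assume "r < dim_vec (0\<^sub>v m :: 'a vec)"
    then have r: "r < m" by simp
    have "(block \<omega> B 1 0 *\<^sub>v u) $ r = (B *\<^sub>v u) $ r"
      using r u B blk \<open>m \<le> n\<close> \<omega>_0 \<omega>_1 by (simp add: scalar_prod_def block_def)
    then show "(block \<omega> B 1 0 *\<^sub>v u) $ r = 0\<^sub>v m $ r"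
      using assms(2) r \<open>m \<le> n\<close> by simp
  qed (use blk in simp)
  moreover have "det (block \<omega> B 1 0) \<noteq> 0"
    using vec_space.det_rank_iff[OF blk] rank_B \<omega>_1 by simp
  ultimately show ?thesis
    using det_0_iff_vec_prod_zero_field[OF blk] u by blast
qed

lemma square_subdiagonal_block_inj:
  assumes i: "Suc i \<in> {2..\<mu>}" and eq: "\<omega> (Suc i) = \<omega> i"
    and x: "x \<in> carrier_vec (\<omega> i)" "block \<omega> A (Suc i) i *\<^sub>v x = 0\<^sub>v (\<omega> (Suc i))"
  shows "x = 0\<^sub>v (\<omega> i)"
proof -
  have blk: "block \<omega> A (Suc i) i \<in> carrier_mat (\<omega> i) (\<omega> i)"
    using block_carrier[of A "Suc i" i] eq by simp
  have "det (block \<omega> A (Suc i) i) \<noteq> 0"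
    using vec_space.det_rank_iff[OF blk] rank_A[OF i] eq by simp
  then show ?thesis
    using det_0_iff_vec_prod_zero_field[OF blk] x eq by auto
qed

text \<open>Descending induction along the staircase. The hypothesis \<open>step\<close> says that \<open>A\<^bsup>i - 1\<^esup> B u\<close> loses its
\<open>i\<close>-th block as soon as its image under \<open>A\<close> has lost block \<open>i + 1\<close>; at \<open>i = \<mu>\<close> there is no block
\<open>i + 1\<close> to lose. What remains in the end is \<open>B u = 0\<close>.\<close>

lemma input_eq_0_if_invisible:
  assumes u: "u \<in> carrier_vec m"
    and step: "\<And>i. i \<in> {1..\<mu>} \<Longrightarrow>
      A *\<^sub>v (A ^\<^sub>m (i - 1) *\<^sub>v (B *\<^sub>v u)) \<in> lead i \<Longrightarrow>
      A ^\<^sub>m (i - 1) *\<^sub>v (B *\<^sub>v u) \<in> lead (i - 1)"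
  shows "u = 0\<^sub>v m"
proof -
  have Bu: "B *\<^sub>v u \<in> carrier_vec n"
    using mult_mat_vec_carrier[OF B u] .
  have "A ^\<^sub>m (i - 1) *\<^sub>v (B *\<^sub>v u) \<in> lead (i - 1)" if "i \<le> \<mu>" "1 \<le> i" for i
    using that
  proof (induction rule: inc_induct)
    case base
    have "A *\<^sub>v (A ^\<^sub>m (\<mu> - 1) *\<^sub>v (B *\<^sub>v u)) \<in> carrier_vec n"
      using mult_mat_vec_carrier[OF A mult_mat_vec_carrier[OF pow_carrier_mat[OF A] Bu]] .
    then show ?case
      using base step[of \<mu>] lead_all by simp
  next
    case (step i)
    have "A ^\<^sub>m i = A * A ^\<^sub>m (i - 1)"
      using pow_mat_add[OF A, of 1 "i - 1"] step.prems A by simp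
    then have "A *\<^sub>v (A ^\<^sub>m (i - 1) *\<^sub>v (B *\<^sub>v u)) = A ^\<^sub>m i *\<^sub>v (B *\<^sub>v u)"
      using A Bu by (simp add: assoc_mult_mat_vec[of A n n _ n])
    then show ?case
      using assms(2)[of i] step by simp
  qed
  from this[of 1] have "B *\<^sub>v u \<in> lead 0"
    using \<mu>_pos Bu A by simp
  then show ?thesis
    using lead_0 input_eq_0[OF u] by simp
qed

text \<open>A row that starts in block \<open>i\<close> sees of a vector in \<open>lead i\<close> only its \<open>i\<close>-th block, through \<open>Sr\<close>; the
entries \<open>Sf\<close> further to the right meet zeros. In particular it does not see
\<open>A\<^sup>l B u\<close>, which lies in \<open>lead (l + 1)\<close>, before step \<open>i - 1\<close>.\<close>

lemma output_block:
  assumes i: "i \<in> {1..\<mu>}" and Sr: "Sr \<in> carrier_mat e (\<omega> i)"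
    and Sf: "Sf \<in> carrier_mat e (\<Sum>l = i + 1..\<mu>. \<omega> l)"
    and C: "C = hstack e [0\<^sub>m e (\<Sum>l = 1..i - 1. \<omega> l), Sr, Sf]"
  shows output_block_carrier: "C \<in> carrier_mat e n"
    and output_block_mult_lead: "v \<in> lead i \<Longrightarrow> C *\<^sub>v v = Sr *\<^sub>v vec_block i v"
    and output_block_early: "l + 1 < i \<Longrightarrow> C * (A ^\<^sub>m l * B) = 0\<^sub>m e m"
proof -
  have "{1..i - 1} = {1..<i}" using i by auto
  then have block_start_i: "(\<Sum>l = 1..i - 1. \<omega> l) = block_start i" by (simp add: block_start_def)
  have "block_start (Suc \<mu>) = block_start (Suc i) + (\<Sum>l = i + 1..\<mu>. \<omega> l)"
    using i sum.atLeastLessThan_concat[of 1 "Suc i" "Suc \<mu>" \<omega>]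
    by (simp add: block_start_def atLeastLessThanSuc_atLeastAtMost)
  then have n: "n = block_start i + \<omega> i + (\<Sum>l = i + 1..\<mu>. \<omega> l)"
    using block_start_end block_start_Suc[of i] i by simp
  note stack = hstack3[where a = "block_start i", OF zero_carrier_mat Sr Sf]
  show C_carrier: "C \<in> carrier_mat e n"
    using stack(1) n unfolding C block_start_i by simp
  show lead: "C *\<^sub>v v = Sr *\<^sub>v vec_block i v" if v: "v \<in> lead i" for v
  proof (rule eq_vecI)
    fix r assume "r < dim_vec (Sr *\<^sub>v vec_block i v)"
    then have r: "r < e" using Sr by simp
    have "(C *\<^sub>v v) $ r = (\<Sum>p = 0..<n. C $$ (r, p) * v $ p)"
      using r C_carrier lead_carrier[OF v] by (simp add: scalar_prod_def)
    also have "\<dots> = (\<Sum>p = block_start i..<block_start (Suc i). C $$ (r, p) * v $ p)"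
    proof (rule sum.mono_neutral_right)
      show "\<forall>p \<in> {0..<n} - {block_start i..<block_start (Suc i)}. C $$ (r, p) * v $ p = 0"
      proof
        fix p assume p: "p \<in> {0..<n} - {block_start i..<block_start (Suc i)}"
        show "C $$ (r, p) * v $ p = 0"
        proof (cases "p < block_start i")
          case True
          then have "C $$ (r, p) = 0"
            using stack(2)[where l = r and p = p] r p n unfolding C block_start_i by simp
          then show ?thesis by simp
        next
          case False
          then show ?thesis using p v by (simp add: lead_def)
        qed
      qed
    qed (use n block_start_Suc[of i] i in auto)
    also have "\<dots> = (\<Sum>q = 0..<\<omega> i. C $$ (r, block_start i + q) * v $ (block_start i + q))"
      using block_start_Suc[of i] i sum.shift_bounds_nat_ivl[of "\<lambda>p. C $$ (r, p) * v $ p" 0 "block_start i" "\<omega> i"]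
      by (simp add: add.commute)
    also have "\<dots> = (\<Sum>q = 0..<\<omega> i. Sr $$ (r, q) * v $ (block_start i + q))"
    proof (rule sum.cong)
      fix q assume "q \<in> {0..<\<omega> i}"
      then show "C $$ (r, block_start i + q) * v $ (block_start i + q) = Sr $$ (r, q) * v $ (block_start i + q)"
        using stack(2)[where l = r and p = "block_start i + q"] r n unfolding C block_start_i by simp
    qed simp
    also have "\<dots> = (Sr *\<^sub>v vec_block i v) $ r"
      using r Sr by (simp add: scalar_prod_def vec_block_def)
    finally show "(C *\<^sub>v v) $ r = (Sr *\<^sub>v vec_block i v) $ r" .
  qed (use Sr C_carrier in simp)
  show "C * (A ^\<^sub>m l * B) = 0\<^sub>m e m" if l: "l + 1 < i"
  proof (rule mat_col_eqI)
    have M: "A ^\<^sub>m l * B \<in> carrier_mat n m"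
      using mult_carrier_mat[OF pow_carrier_mat[OF A] B] .
    fix q assume "q < dim_col (0\<^sub>m e m :: 'a mat)"
    then have q: "q < m" by simp
    have u: "unit_vec m q \<in> carrier_vec m" by simp
    have "col (C * (A ^\<^sub>m l * B)) q = C *\<^sub>v col (A ^\<^sub>m l * B) q"
      using col_mult2[OF C_carrier M q] .
    also have "col (A ^\<^sub>m l * B) q = A ^\<^sub>m l *\<^sub>v (B *\<^sub>v unit_vec m q)"
      using mult_mat_unit_vec[OF M q] assoc_mult_mat_vec[OF pow_carrier_mat[OF A] B u] by simp
    also have "C *\<^sub>v \<dots> = 0\<^sub>v e"
    proof -
      have in_lead: "A ^\<^sub>m l *\<^sub>v (B *\<^sub>v unit_vec m q) \<in> lead (i - 1)"
      proof -
        have "Suc l \<le> i - 1" using l by simp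
        then show ?thesis
          using input_in_lead[OF u, of l] lead_mono by blast
      qed
      then have "A ^\<^sub>m l *\<^sub>v (B *\<^sub>v unit_vec m q) \<in> lead i"
        using lead_mono[of "i - 1" i] by auto
      then show ?thesis
        using lead vec_block_eq_0[OF in_lead i] Sr by auto
    qed
    finally show "col (C * (A ^\<^sub>m l * B)) q = col (0\<^sub>m e m) q"
      using q by simp
  qed (use C_carrier B in simp_all)
qed

end

section \<open>Output matrices of a staircase pair\<close>

lemma rows_vstack:
  assumes "\<And>X. X \<in> set Xs \<Longrightarrow> dim_col X = nc"
  shows "rows (vstack nc Xs) = concat (map rows Xs)"
proof -
  have "set (concat (map rows Xs)) \<subseteq> carrier_vec nc"
  proof
    fix r assume "r \<in> set (concat (map rows Xs))"
    then obtain X where "X \<in> set Xs" "r \<in> set (rows X)" by auto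
    then show "r \<in> carrier_vec nc"
      using rows_carrier[of X] assms[of X] by blast
  qed
  then show ?thesis
    unfolding vstack_def by simp
qed

lemma vstack_mult_vec_eq_0_iff:
  assumes Xs: "\<And>X. X \<in> set Xs \<Longrightarrow> dim_col X = nc"
  shows "vstack nc Xs *\<^sub>v v = 0\<^sub>v (dim_row (vstack nc Xs)) \<longleftrightarrow>
    (\<forall>X \<in> set Xs. X *\<^sub>v v = 0\<^sub>v (dim_row X))"
proof -
  have *: "M *\<^sub>v v = 0\<^sub>v (dim_row M) \<longleftrightarrow> (\<forall>r \<in> set (rows M). r \<bullet> v = 0)" for M :: "'a :: semiring_0 mat"
  proof -
    have "M *\<^sub>v v = 0\<^sub>v (dim_row M) \<longleftrightarrow> (\<forall>i < dim_row M. row M i \<bullet> v = 0)"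
      by (auto simp: vec_eq_iff)
    then show ?thesis by (auto simp: rows_def)
  qed
  have "rows (vstack nc Xs) = concat (map rows Xs)"
    by (rule rows_vstack) (rule Xs)
  then show ?thesis
    unfolding * by auto
qed

lemma concat_map_concat_map:
  "concat (map h (concat (map f js))) = concat (map (\<lambda>j. concat (map h (f j))) js)"
  by (induction js) auto

lemma sum_list_concat: "sum_list (concat xss) = sum_list (map sum_list xss)"
  by (induction xss) auto

lemma map_nth_pair:
  "map (\<lambda>a. h (fst (xs ! a)) (snd (xs ! a))) [0..<length xs] = map (\<lambda>(x, y). h x y) xs"
  by (rule nth_equalityI) (auto split: prod.split)

locale staircase_outputs = staircase_pair n m \<mu> \<omega> A B
  for n m \<mu> :: nat and \<omega> :: "nat \<Rightarrow> nat" and A B :: "'a :: field mat" +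
  fixes g :: nat and \<epsilon> k :: "nat \<Rightarrow> nat" and Sr Sf C :: "nat \<Rightarrow> 'a mat"
  assumes \<omega>_end: "\<omega> (\<mu> + 1) = 0"
    and \<epsilon>: "\<And>i. i \<in> {1..\<mu>} \<Longrightarrow> \<epsilon> i = \<omega> i - \<omega> (i + 1)"
    and k_step: "\<And>j. j \<in> {1..<g} \<Longrightarrow> k (j + 1) < k j"
    and k_image: "k ` {1..g} = {i \<in> {1..\<mu>}. \<epsilon> i > 0}"
    and Sr: "\<And>j. j \<in> {1..g} \<Longrightarrow> Sr (k j) \<in> carrier_mat (\<epsilon> (k j)) (\<omega> (k j))"
    and Sf: "\<And>j. j \<in> {1..g} \<Longrightarrow> Sf (k j) \<in> carrier_mat (\<epsilon> (k j)) (\<Sum>i = k j + 1..\<mu>. \<omega> i)"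
    and Sr_1: "invertible_mat (Sr (k 1))"
    and stack_invertible: "\<And>j. j \<in> {2..g} \<Longrightarrow>
           invertible_mat (vstack (\<omega> (k j)) [block \<omega> A (k j + 1) (k j), Sr (k j)])"
    and C: "\<And>j. j \<in> {1..g} \<Longrightarrow>
           C j = hstack (\<epsilon> (k j)) [0\<^sub>m (\<epsilon> (k j)) (\<Sum>i = 1..k j - 1. \<omega> i), Sr (k j), Sf (k j)]"
begin

lemma \<omega>_step: "i \<in> {1..\<mu>} \<Longrightarrow> \<omega> (i + 1) \<le> \<omega> i"
  using \<omega>_decreasing[of i] \<omega>_end by (cases "i = \<mu>") auto

lemma k_range: "j \<in> {1..g} \<Longrightarrow> k j \<in> {1..\<mu>} \<and> 0 < \<epsilon> (k j)"
  using k_image by blast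

lemma k_strict: "i \<in> {1..g} \<Longrightarrow> j \<in> {1..g} \<Longrightarrow> i < j \<Longrightarrow> k j < k i"
proof (induction j)
  case (Suc j)
  have "k (Suc j) < k j"
    using k_step[of j] Suc.prems by simp
  then show ?case
    using Suc by (cases "i = j") auto
qed simp

lemma k_inj: "inj_on k {1..g}"
  by (rule inj_onI) (metis k_strict less_irrefl nat_neq_iff)

lemma k_1: "k 1 = \<mu>"
proof -
  have "\<mu> \<in> k ` {1..g}"
    unfolding k_image using \<mu>_pos \<epsilon>[of \<mu>] \<omega>_pos[of \<mu>] \<omega>_end by simp
  then obtain j where j: "j \<in> {1..g}" "k j = \<mu>" by auto
  then have g: "1 \<le> g" by simp
  show "k 1 = \<mu>"
    using k_strict[of 1 j] k_range[of 1] j g by (cases "j = 1") auto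
qed

lemma sum_over_k:
  assumes "\<And>i. \<epsilon> i = 0 \<Longrightarrow> f i = 0"
  shows "(\<Sum>j = 1..g. f (k j)) = (\<Sum>i = 1..\<mu>. (f i :: nat))"
proof -
  have "(\<Sum>j = 1..g. f (k j)) = sum f (k ` {1..g})"
    using sum.reindex[OF k_inj, of f] by simp
  also have "\<dots> = (\<Sum>i = 1..\<mu>. f i)"
    unfolding k_image using assms by (intro sum.mono_neutral_left) auto
  finally show ?thesis .
qed

text \<open>Summation by parts, with the boundary term on the left to avoid truncated subtraction.\<close>

lemma sum_\<epsilon>_telescope:
  "M \<le> \<mu> \<Longrightarrow> (\<Sum>i = 1..M. \<epsilon> i) + \<omega> (M + 1) = \<omega> 1"
  "M \<le> \<mu> \<Longrightarrow> (\<Sum>i = 1..M. \<epsilon> i * i) + M * \<omega> (M + 1) = (\<Sum>i = 1..M. \<omega> i)"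
proof (induction M)
  case (Suc M)
  have e: "\<epsilon> (Suc M) + \<omega> (Suc M + 1) = \<omega> (Suc M)" if "Suc M \<le> \<mu>"
    using \<epsilon>[of "Suc M"] \<omega>_step[of "Suc M"] that by simp
  { case 1
    then show ?case using Suc.IH(1) e by simp
  next
    case 2
    have "\<epsilon> (Suc M) * Suc M + Suc M * \<omega> (Suc M + 1) = Suc M * \<omega> (Suc M)"
      unfolding e[OF 2, symmetric] by (simp add: algebra_simps)
    then show ?case using Suc.IH(2) 2 by simp
  }
qed simp_all

lemma sum_\<epsilon>: "(\<Sum>j = 1..g. \<epsilon> (k j)) = m"
  using sum_\<epsilon>_telescope(1)[of \<mu>] \<omega>_1 \<omega>_end sum_over_k[of \<epsilon>] by simp

lemma sum_\<epsilon>_k: "(\<Sum>j = 1..g. \<epsilon> (k j) * k j) = n"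
  using sum_\<epsilon>_telescope(2)[of \<mu>] sum_\<omega> \<omega>_end sum_over_k[of "\<lambda>i. \<epsilon> i * i"] by simp

lemma C_props:
  assumes "j \<in> {1..g}"
  shows C_carrier: "C j \<in> carrier_mat (\<epsilon> (k j)) n"
    and C_mult_lead: "v \<in> lead (k j) \<Longrightarrow> C j *\<^sub>v v = Sr (k j) *\<^sub>v vec_block (k j) v"
    and C_early: "l + 1 < k j \<Longrightarrow> C j * (A ^\<^sub>m l * B) = 0\<^sub>m (\<epsilon> (k j)) m"
  using output_block[OF _ Sr[OF assms] Sf[OF assms] C[OF assms]] k_range[OF assms] by auto

text \<open>The rows of all \<open>C j\<close> from top to bottom, each with its chain length.\<close>

definition outputs :: "('a vec \<times> nat) list" where
  "outputs = concat (map (\<lambda>j. map (\<lambda>r. (r, k j)) (rows (C j))) [1..<g + 1])"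

lemma set_upt: "j \<in> set [1..<g + 1] \<longleftrightarrow> j \<in> {1..g}"
  by auto

lemma length_rows_C: "j \<in> {1..g} \<Longrightarrow> length (rows (C j)) = \<epsilon> (k j)"
  using carrier_matD(1)[OF C_carrier] by simp

lemma sum_list_upt: "sum_list (map f [1..<g + 1]) = (\<Sum>j = 1..g. f j)"
  by (simp add: interv_sum_list_conv_sum_set_nat atLeastLessThanSuc_atLeastAtMost del: upt_Suc)

lemma length_outputs: "length outputs = m"
proof -
  have "length outputs = sum_list (map (\<lambda>j. \<epsilon> (k j)) [1..<g + 1])"
    unfolding outputs_def length_concat map_map comp_def length_map
    by (intro arg_cong[of _ _ sum_list] map_cong refl length_rows_C) (simp only: set_upt)
  then show ?thesis
    unfolding sum_list_upt sum_\<epsilon> .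
qed

lemma map_snd_outputs:
  "map snd outputs = concat (map (\<lambda>j. replicate (\<epsilon> (k j)) (k j)) [1..<g + 1])"
  unfolding outputs_def map_concat map_map comp_def snd_conv
  by (intro arg_cong[of _ _ concat] map_cong refl)
    (simp only: set_upt map_replicate_const length_rows_C)

lemma sum_list_snd_outputs: "sum_list (map snd outputs) = n"
proof -
  have "sum_list (map snd outputs) = sum_list (map (\<lambda>j. \<epsilon> (k j) * k j) [1..<g + 1])"
    unfolding map_snd_outputs by (simp add: sum_list_concat comp_def sum_list_replicate del: upt_Suc)
  then show ?thesis
    unfolding sum_list_upt sum_\<epsilon>_k .
qed

lemma sorted_outputs: "sorted (rev (map snd outputs))"
proof -
  have const: "sorted_wrt (\<ge>) (replicate l x)" for l x :: nat
    by (induction l) auto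
  have "sorted_wrt (\<ge>) (concat (map (\<lambda>j. replicate (\<epsilon> (k j)) (k j)) [1..<G + 1]))" if "G \<le> g" for G
    using that
  proof (induction G)
    case (Suc G)
    have "k (Suc G) \<le> k j" if "j \<in> {1..G}" for j
      using k_strict[of j "Suc G"] that Suc.prems by simp
    then show ?case
      using Suc const by (auto simp: sorted_wrt_append)
  qed simp
  then show ?thesis
    unfolding map_snd_outputs sorted_wrt_rev by simp
qed

lemma lengths_eq: "map (\<lambda>a. snd (outputs ! a)) [0..<m] = map snd outputs"
  using map_nth_pair[of "\<lambda>r i. i" outputs] length_outputs by (simp add: split_def)

lemma outputs_nth:
  assumes "a < m"
  obtains j l where "j \<in> {1..g}" "l < \<epsilon> (k j)" "outputs ! a = (row (C j) l, k j)"
proof -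
  have "outputs ! a \<in> set outputs"
    using assms length_outputs by simp
  then obtain j where j: "j \<in> {1..g}" "outputs ! a \<in> (\<lambda>r. (r, k j)) ` set (rows (C j))"
    unfolding outputs_def by force
  then obtain l where "l < length (rows (C j))" "outputs ! a = (rows (C j) ! l, k j)"
    by (auto simp: in_set_conv_nth)
  then show thesis
    using that[of j l] j length_rows_C[OF j(1)] by simp
qed

lemma rows_C_mult:
  assumes "j \<in> {1..g}" and "M \<in> carrier_mat n nc"
  shows "rows (C j * M) = map (\<lambda>r. M\<^sup>T *\<^sub>v r) (rows (C j))"
  using rows_mult[OF C_carrier[OF assms(1)] assms(2)] .

lemma map_outputs:
  "map (\<lambda>a. h (fst (outputs ! a)) (snd (outputs ! a))) [0..<m]
    = concat (map (\<lambda>j. map (\<lambda>r. h r (k j)) (rows (C j))) [1..<g + 1])"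
proof -
  have "map (\<lambda>a. h (fst (outputs ! a)) (snd (outputs ! a))) [0..<m] = map (\<lambda>(r, i). h r i) outputs"
    using map_nth_pair[of h outputs] unfolding length_outputs .
  also have "\<dots> = concat (map (\<lambda>j. map (\<lambda>r. h r (k j)) (rows (C j))) [1..<g + 1])"
    unfolding outputs_def map_concat by (simp add: comp_def del: upt_Suc)
  finally show ?thesis .
qed

lemma stacked_outputs:
  assumes "\<And>i. M i \<in> carrier_mat n nc"
  shows "vstack nc (map (\<lambda>j. C j * M (k j)) [1..<g + 1])
    = mat_of_rows nc (map (\<lambda>a. (M (snd (outputs ! a)))\<^sup>T *\<^sub>v fst (outputs ! a)) [0..<m])"
proof -
  have "concat (map rows (map (\<lambda>j. C j * M (k j)) [1..<g + 1]))
      = concat (map (\<lambda>j. map (\<lambda>r. (M (k j))\<^sup>T *\<^sub>v r) (rows (C j))) [1..<g + 1])"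
    unfolding map_map comp_def
    by (intro arg_cong[of _ _ concat] map_cong refl rows_C_mult[OF _ assms]) (simp only: set_upt)
  then show ?thesis
    unfolding vstack_def using map_outputs[of "\<lambda>r i. (M i)\<^sup>T *\<^sub>v r"] by simp
qed

definition decoupling :: "'a mat" where
  "decoupling = vstack m (map (\<lambda>j. C j * (A ^\<^sub>m (k j - 1) * B)) [1..<g + 1])"

lemma input_power_carrier: "A ^\<^sub>m i * B \<in> carrier_mat n m"
  using mult_carrier_mat[OF pow_carrier_mat[OF A] B] .

lemma decoupling_eq: "decoupling = mat_of_rows m
    (map (\<lambda>a. (A ^\<^sub>m (snd (outputs ! a) - 1) * B)\<^sup>T *\<^sub>v fst (outputs ! a)) [0..<m])"
  unfolding decoupling_def by (rule stacked_outputs) (rule input_power_carrier)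

lemma decoupling_carrier: "decoupling \<in> carrier_mat m m"
  unfolding decoupling_eq by (rule carrier_matI) simp_all

text \<open>Two kinds of information about the block \<open>x = vec_block i v\<close> are available: the subdiagonal block annihilates
it, since block \<open>i + 1\<close> of \<open>A v\<close> vanishes, and \<open>Sr i\<close> annihilates it if \<open>\<epsilon> i > 0\<close>. For \<open>i = \<mu>\<close> the second suffices, for \<open>\<epsilon> i = 0\<close> the
first does, and otherwise the stacked matrix has trivial kernel.\<close>

lemma vec_block_eq_0_if_invisible:
  assumes i: "i \<in> {1..\<mu>}" and v: "v \<in> lead i" and Av: "A *\<^sub>v v \<in> lead i"
    and out: "\<And>j. j \<in> {1..g} \<Longrightarrow> i = k j \<Longrightarrow> C j *\<^sub>v v = 0\<^sub>v (\<epsilon> i)"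
  shows "vec_block i v = 0\<^sub>v (\<omega> i)"
proof -
  have next_block: "block \<omega> A (Suc i) i *\<^sub>v vec_block i v = 0\<^sub>v (\<omega> (Suc i))" if "i < \<mu>"
    using vec_block_A_mult[OF v] vec_block_eq_0[of "A *\<^sub>v v" "Suc i"] Av i that by simp
  show ?thesis
  proof (cases "\<epsilon> i = 0")
    case True
    then have eq: "\<omega> (Suc i) = \<omega> i"
      using \<epsilon>[OF i] \<omega>_step[OF i] by simp
    then have "i < \<mu>"
      using \<omega>_pos[OF i] \<omega>_end i by (cases "i = \<mu>") auto
    then show ?thesis
      using square_subdiagonal_block_inj[OF _ eq vec_block_carrier next_block] i by simp
  next
    case False
    then have "i \<in> k ` {1..g}"
      unfolding k_image using i by simp
    then obtain j where j: "j \<in> {1..g}" "i = k j" by auto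
    have Sr_0: "Sr i *\<^sub>v vec_block i v = 0\<^sub>v (\<epsilon> i)"
      using C_mult_lead[OF j(1)] out[OF j] v j(2) by simp
    note Sr_i = Sr[OF j(1), folded j(2)]
    show ?thesis
    proof (cases "j = 1")
      case True
      then have "i = \<mu>" using j k_1 by simp
      then have "\<epsilon> i = \<omega> i"
        using \<epsilon>[OF i] \<omega>_end by simp
      then show ?thesis
        using invertible_mat_imp_kernel_trivial[of "Sr i" "\<omega> i"] Sr_1 True j Sr_i Sr_0 by simp
    next
      case False
      then have "i < \<mu>"
        using k_strict[of 1 j] k_1 j by simp
      let ?blk = "block \<omega> A (Suc i) i" and ?V = "vstack (\<omega> i) [block \<omega> A (Suc i) i, Sr i]"
      have dims: "dim_col ?blk = \<omega> i" "dim_row ?blk = \<omega> (Suc i)"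
        "dim_col (Sr i) = \<omega> i" "dim_row (Sr i) = \<epsilon> i"
        using carrier_matD[OF block_carrier[of A "Suc i" i]] carrier_matD[OF Sr_i] by simp_all
      have V: "?V \<in> carrier_mat (\<omega> i) (\<omega> i)"
        using \<epsilon>[OF i] \<omega>_step[OF i] dims unfolding vstack_def by (intro carrier_matI) simp_all
      have "?V *\<^sub>v vec_block i v = 0\<^sub>v (\<omega> i)"
        using vstack_mult_vec_eq_0_iff[of "[?blk, Sr i]" "\<omega> i" "vec_block i v"] dims
          next_block[OF \<open>i < \<mu>\<close>] Sr_0 carrier_matD[OF V] by auto
      moreover have "invertible_mat ?V"
        using stack_invertible[of j] False j by simp
      ultimately show ?thesis
        using invertible_mat_imp_kernel_trivial[OF _ V vec_block_carrier] by simp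
    qed
  qed
qed

text \<open>A vector in the kernel is an input that no output sees when it first could. Such an input leaves no
trace in any block, by descent along the staircase.\<close>

lemma det_decoupling: "det decoupling \<noteq> 0"
proof (rule mult_mat_vec_eq_0_imp_det_nonzero[OF decoupling_carrier])
  fix u assume u: "u \<in> carrier_vec m" and "decoupling *\<^sub>v u = 0\<^sub>v m"
  let ?Xs = "map (\<lambda>j. C j * (A ^\<^sub>m (k j - 1) * B)) [1..<g + 1]"
  have "decoupling *\<^sub>v u = 0\<^sub>v (dim_row decoupling)"
    using \<open>decoupling *\<^sub>v u = 0\<^sub>v m\<close> carrier_matD(1)[OF decoupling_carrier] by simp
  moreover have "dim_col X = m" if "X \<in> set ?Xs" for X
    using that carrier_matD(2)[OF input_power_carrier] by (auto simp del: upt_Suc)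
  ultimately have Xs: "\<forall>X \<in> set ?Xs. X *\<^sub>v u = 0\<^sub>v (dim_row X)"
    unfolding decoupling_def using vstack_mult_vec_eq_0_iff[of ?Xs m u] by blast
  then have out: "(C j * (A ^\<^sub>m (k j - 1) * B)) *\<^sub>v u = 0\<^sub>v (\<epsilon> (k j))" if "j \<in> {1..g}" for j
  proof -
    have "C j * (A ^\<^sub>m (k j - 1) * B) \<in> set ?Xs"
      unfolding set_map using that by (intro imageI) (simp only: set_upt)
    then show ?thesis
      using bspec[OF Xs] carrier_matD(1)[OF C_carrier[OF that]] by simp
  qed
  show "u = 0\<^sub>v m"
  proof (rule input_eq_0_if_invisible[OF u])
    fix i assume i: "i \<in> {1..\<mu>}"
    let ?v = "A ^\<^sub>m (i - 1) *\<^sub>v (B *\<^sub>v u)"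
    assume Av: "A *\<^sub>v ?v \<in> lead i"
    have v: "?v \<in> lead i"
      using input_in_lead[OF u, of "i - 1"] i by simp
    have "C j *\<^sub>v ?v = 0\<^sub>v (\<epsilon> i)" if "j \<in> {1..g}" "i = k j" for j
    proof -
      have "?v = (A ^\<^sub>m (i - 1) * B) *\<^sub>v u"
        using assoc_mult_mat_vec[OF pow_carrier_mat[OF A] B u] by simp
      then show ?thesis
        using out[OF that(1)] that assoc_mult_mat_vec[OF C_carrier[OF that(1)] input_power_carrier u]
        by simp
    qed
    then have "vec_block i ?v = 0\<^sub>v (\<omega> i)"
      using vec_block_eq_0_if_invisible[OF i v Av] by blast
    then show "?v \<in> lead (i - 1)"
      using lead_pred[OF _ v] i by simp
  qed
qed

sublocale flat: flat_outputs n m A B "\<lambda>a. fst (outputs ! a)" "\<lambda>a. snd (outputs ! a)"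
proof unfold_locales
  show "A \<in> carrier_mat n n" "B \<in> carrier_mat n m"
    by (fact A, fact B)
  fix a assume a: "a < m"
  obtain j l where jl: "j \<in> {1..g}" "l < \<epsilon> (k j)" "outputs ! a = (row (C j) l, k j)"
    using outputs_nth[OF a] .
  show "fst (outputs ! a) \<in> carrier_vec n"
    using row_carrier[of "C j" l] unfolding carrier_matD(2)[OF C_carrier[OF jl(1)]] jl(3) by simp
  show "1 \<le> snd (outputs ! a)"
    using jl k_range by simp
  fix i assume "i + 1 < snd (outputs ! a)"
  then have "C j * (A ^\<^sub>m i * B) = 0\<^sub>m (\<epsilon> (k j)) m"
    using C_early[OF jl(1)] jl(3) by simp
  then have "rows (0\<^sub>m (\<epsilon> (k j)) m) ! l = (A ^\<^sub>m i * B)\<^sup>T *\<^sub>v rows (C j) ! l"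
    using rows_C_mult[OF jl(1) input_power_carrier[of i]] jl(2) length_rows_C[OF jl(1)] by simp
  then show "(A ^\<^sub>m i * B)\<^sup>T *\<^sub>v fst (outputs ! a) = 0\<^sub>v m"
    using jl carrier_matD[OF C_carrier[OF jl(1)]] by simp
next
  have "sum_list (map (\<lambda>a. snd (outputs ! a)) [0..<m]) = n"
    unfolding lengths_eq by (rule sum_list_snd_outputs)
  then show "(\<Sum>a<m. snd (outputs ! a)) = n"
    by (simp add: interv_sum_list_conv_sum_set_nat atLeast0LessThan)
next
  show "det (mat_of_rows m (map (\<lambda>a. (A ^\<^sub>m (snd (outputs ! a) - 1) * B)\<^sup>T *\<^sub>v fst (outputs ! a)) [0..<m])) \<noteq> 0"
    using det_decoupling unfolding decoupling_eq .
qed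

lemma flat_D_eq: "flat.D = decoupling"
  unfolding flat.D_def decoupling_eq ..

lemma flat_C'_eq: "flat.C' = vstack n (map (\<lambda>j. C j * A ^\<^sub>m k j) [1..<g + 1])"
  unfolding flat.C'_def flat.coord_def
  by (rule stacked_outputs[symmetric]) (rule pow_carrier_mat[OF A])

lemma rows_orbit_matrix:
  assumes "r \<in> carrier_vec n"
  shows "rows (vstack n (map (\<lambda>i. mat_of_row r * A ^\<^sub>m i) [0..<l]))
    = map (\<lambda>i. (A ^\<^sub>m i)\<^sup>T *\<^sub>v r) [0..<l]"
proof -
  have row: "mat_of_row r \<in> carrier_mat 1 n" "rows (mat_of_row r) = [r]"
    using assms by (auto simp: mat_of_row_def mat_of_rows_def rows_def row_def intro!: eq_vecI)
  have "rows (mat_of_row r * A ^\<^sub>m i) = [(A ^\<^sub>m i)\<^sup>T *\<^sub>v r]" for i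
    using rows_mult[OF row(1) pow_carrier_mat[OF A]] row(2) by simp
  moreover have "dim_col (mat_of_row r * A ^\<^sub>m i) = n" for i
    using carrier_matD(2)[OF pow_carrier_mat[OF A]] by simp
  ultimately show ?thesis
    by (subst rows_vstack) (auto simp: comp_def)
qed

text \<open>The nested stacking by \<open>j\<close>, by row of \<open>C j\<close> and by power of \<open>A\<close> lists the coordinates in the same
order as the flat list \<open>outputs\<close>.\<close>

lemma flat_T_eq:
  assumes T2: "\<And>j l. j \<in> {1..g} \<Longrightarrow> l \<in> {1..\<epsilon> (k j)} \<Longrightarrow>
      T2 j l = vstack n (map (\<lambda>i. mat_of_row (row (C j) (l - 1)) * A ^\<^sub>m i) [0..<k j])"
    and T1: "\<And>j. j \<in> {1..g} \<Longrightarrow> T1 j = vstack n (map (T2 j) [1..<\<epsilon> (k j) + 1])"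
  shows "vstack n (map T1 [1..<g + 1]) = flat.T"
proof -
  let ?orbit = "\<lambda>r i. map (\<lambda>s. (A ^\<^sub>m s)\<^sup>T *\<^sub>v r) [0..<i]"
  have "rows (T1 j) = concat (map (\<lambda>r. ?orbit r (k j)) (rows (C j)))" if j: "j \<in> {1..g}" for j
  proof -
    have range: "l \<in> set [1..<\<epsilon> (k j) + 1] \<longleftrightarrow> l \<in> {1..\<epsilon> (k j)}" for l by auto
    have "rows (T1 j) = concat (map (\<lambda>l. rows (T2 j l)) [1..<\<epsilon> (k j) + 1])"
      unfolding T1[OF j]
      by (subst rows_vstack) (auto simp: comp_def T2[OF j] vstack_def simp del: upt_Suc)
    also have "\<dots> = concat (map (\<lambda>l. ?orbit (row (C j) (l - 1)) (k j)) [1..<\<epsilon> (k j) + 1])"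
    proof (intro arg_cong[of _ _ concat] map_cong refl)
      fix l assume "l \<in> set [1..<\<epsilon> (k j) + 1]"
      then have l: "l \<in> {1..\<epsilon> (k j)}" unfolding range .
      have "row (C j) (l - 1) \<in> carrier_vec n"
        using row_carrier[of "C j" "l - 1"] unfolding carrier_matD(2)[OF C_carrier[OF j]] .
      then show "rows (T2 j l) = ?orbit (row (C j) (l - 1)) (k j)"
        unfolding T2[OF j l] by (rule rows_orbit_matrix)
    qed
    also have "[1..<\<epsilon> (k j) + 1] = map Suc [0..<\<epsilon> (k j)]"
      by (simp add: map_Suc_upt del: upt_Suc)
    also have "concat (map (\<lambda>l. ?orbit (row (C j) (l - 1)) (k j)) (map Suc [0..<\<epsilon> (k j)]))
        = concat (map (\<lambda>r. ?orbit r (k j)) (rows (C j)))"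
      using carrier_matD(1)[OF C_carrier[OF j]] by (simp add: rows_def comp_def)
    finally show ?thesis .
  qed
  then have "concat (map rows (map T1 [1..<g + 1]))
      = concat (map (\<lambda>j. concat (map (\<lambda>r. ?orbit r (k j)) (rows (C j)))) [1..<g + 1])"
    unfolding map_map comp_def
    by (intro arg_cong[of _ _ concat] map_cong refl) (simp only: set_upt)
  also have "\<dots> = concat (concat (map (\<lambda>j. map (\<lambda>r. ?orbit r (k j)) (rows (C j))) [1..<g + 1]))"
    using concat_map_concat_map[of id "\<lambda>j. map (\<lambda>r. ?orbit r (k j)) (rows (C j))"]
    by (simp del: upt_Suc)
  also have "concat (map (\<lambda>j. map (\<lambda>r. ?orbit r (k j)) (rows (C j))) [1..<g + 1])
      = map (\<lambda>a. ?orbit (fst (outputs ! a)) (snd (outputs ! a))) [0..<m]"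
    by (rule map_outputs[symmetric])
  finally show ?thesis
    unfolding flat.T_def flat.coord_def[abs_def] vstack_def by simp
qed

end

theorem theorem3:
  fixes n m \<mu> g :: nat
    and \<omega> \<epsilon> k :: "nat \<Rightarrow> nat"
    and A\<^sub>s B\<^sub>s T D C' F G :: "real mat"
    and S\<^sub>r S\<^sub>f C T\<^sub>1 :: "nat \<Rightarrow> real mat"
    and T\<^sub>2 :: "nat \<Rightarrow> nat \<Rightarrow> real mat"
    and ctr :: "nat list"
  assumes "1 \<le> m" and "m \<le> n"
    and "staircase_form n m \<mu> \<omega> A\<^sub>s B\<^sub>s"
    and "ctr = controllability_indices A\<^sub>s B\<^sub>s"
    and "\<omega> (\<mu> + 1) = 0"
    and "\<And>i. i \<in> {1..\<mu>} \<Longrightarrow> \<epsilon> i = \<omega> i - \<omega> (i + 1)"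
    and "\<And>j. j \<in> {1..<g} \<Longrightarrow> k (j + 1) < k j"
    and "k ` {1..g} = {i \<in> {1..\<mu>}. \<epsilon> i > 0}"
    and "\<And>j. j \<in> {1..g} \<Longrightarrow> S\<^sub>r (k j) \<in> carrier_mat (\<epsilon> (k j)) (\<omega> (k j))"
    and "\<And>j. j \<in> {1..g} \<Longrightarrow> S\<^sub>f (k j) \<in> carrier_mat (\<epsilon> (k j)) (\<Sum>i = k j + 1..\<mu>. \<omega> i)"
    and "invertible_mat (S\<^sub>r (k 1))"
    and "\<And>j. j \<in> {2..g} \<Longrightarrow>
           invertible_mat (vstack (\<omega> (k j)) [block \<omega> A\<^sub>s (k j + 1) (k j), S\<^sub>r (k j)])"
    and "\<And>j. j \<in> {1..g} \<Longrightarrow>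
           C j = hstack (\<epsilon> (k j))
                   [0\<^sub>m (\<epsilon> (k j)) (\<Sum>i = 1..k j - 1. \<omega> i), S\<^sub>r (k j), S\<^sub>f (k j)]"
    and "\<And>j l. j \<in> {1..g} \<Longrightarrow> l \<in> {1..\<epsilon> (k j)} \<Longrightarrow>
           T\<^sub>2 j l = vstack n (map (\<lambda>i. mat_of_row (row (C j) (l - 1)) * A\<^sub>s ^\<^sub>m i) [0..<k j])"
    and "\<And>j. j \<in> {1..g} \<Longrightarrow> T\<^sub>1 j = vstack n (map (T\<^sub>2 j) [1..<\<epsilon> (k j) + 1])"
    and "T = vstack n (map T\<^sub>1 [1..<g + 1])"
    and "D = vstack m (map (\<lambda>j. C j * A\<^sub>s ^\<^sub>m (k j - 1) * B\<^sub>s) [1..<g + 1])"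
    and "C' = vstack n (map (\<lambda>j. C j * A\<^sub>s ^\<^sub>m k j) [1..<g + 1])"
    and "G = mat_inv D"
    and "F = - mat_inv D * C'"
  shows "invertible_mat D \<and> invertible_mat T \<and>
         T * (A\<^sub>s + B\<^sub>s * F) * mat_inv T = brunovsky_A ctr \<and>
         T * B\<^sub>s * G = brunovsky_B ctr"
proof -
  interpret S: staircase_outputs n m \<mu> \<omega> A\<^sub>s B\<^sub>s g \<epsilon> k S\<^sub>r S\<^sub>f C
    using assms by unfold_locales auto
  note A = S.A and B = S.B
  have D: "D = S.flat.D"
  proof -
    have "C j * A\<^sub>s ^\<^sub>m (k j - 1) * B\<^sub>s = C j * (A\<^sub>s ^\<^sub>m (k j - 1) * B\<^sub>s)" if "j \<in> {1..g}" for j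
      using assoc_mult_mat[OF S.C_carrier[OF that] pow_carrier_mat[OF A] B] .
    then show ?thesis
      unfolding \<open>D = _\<close> S.flat_D_eq S.decoupling_def
      by (intro arg_cong[of _ _ "vstack m"] map_cong refl) (simp only: S.set_upt)
  qed
  have T: "T = S.flat.T"
    unfolding \<open>T = _\<close> using assms(14,15) by (rule S.flat_T_eq)
  have F: "F = S.flat.F"
    unfolding \<open>F = _\<close> S.flat.F_def D S.flat_C'_eq \<open>C' = _\<close> ..
  have ctr: "ctr = map (\<lambda>a. snd (S.outputs ! a)) [0..<m]"
    unfolding \<open>ctr = _\<close>
    by (rule S.flat.controllability_indices_eq_lengths) (simp only: S.lengths_eq S.sorted_outputs)
  show ?thesis
    unfolding \<open>G = _\<close> D T F ctr
    using S.flat.brunovsky_form mat_inv_invertible(1)[OF S.flat.D_carrier S.flat.det_D]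
      mat_inv_invertible(1)[OF S.flat.T_carrier S.flat.det_T] by simp
qed

end
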